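(* Let $A_S$ be an Artin group of FC type with finite standard generating set $S$ and labels $m_{s,t}\in\{2,3,\dots\}\cup\{\infty\}$ for distinct $s,t\in S$. Then $A_S$ admits retractions to all of its standard parabolic subgroups if and only if for every three pairwise distinct elements of $S$ the three labels between them form (in some order) a triple of one of the following types: $(2,2,k)$, $(2m,2n,\infty)$ or $(k,\infty,\infty)$, where $m,n$ are positive integers and $k\in\{2,3,\dots\}\cup\{\infty\}$. Moreover, in this case, for every $X\subseteq S$ the assignment $\rho_X(x)=x$ for $x\in X$; $\rho_X(v)=a$ if $v\in S\setminus X$ and there is $a\in X$ with $m_{v,a}$ odd; and $\rho_X(v)=1$ for all other $v\in S\setminus X$, is well defined and extends to a retraction $\rho_X\colon A_S\to A_X$.
   Context: Given a finite set $S$ and labels $m_{s,t}=m_{t,s}\in\{2,3,\dots\}\cup\{\infty\}$ for $s\neq t$ in $S$, the Artin group $A_S$ is the group with generating set $S$ and one relation $sts\cdots=tst\cdots$ ($m_{s,t}$ letters on each side) for each pair $s\ne t$ with $m_{s,t}\neq\infty$. Odd and even labels are understood to be finite. The associated Coxeter group is the quotient of $A_S$ by the relations $s^2=1$, $s\in S$. $A_S$ is of spherical type if its Coxeter group is finite. $A_S$ is of FC type if for every $T\subseteq S$ with $m_{s,t}\ne\infty$ for all distinct $s,t\in T$, the Artin group $A_T$ (defined by the labels restricted to $T$) is of spherical type. For $X\subseteq S$ the standard parabolic subgroup $A_X$ is the subgroup of $A_S$ generated by $X$ (it is known to be the Artin group defined by the restricted labels). A retraction from a group $G$ to a subgroup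 $H$ is a homomorphism $\rho\colon G\to H$ with $\rho|_H=\mathrm{id}_H$. "Admits retractions to all standard parabolic subgroups" means that for every $X\subseteq S$ there is a retraction $A_S\to A_X$. *)

theory Defs
  imports
    "HOL-Algebra.Generated_Groups"
    "HOL-Library.Extended_Nat"
    "HOL-Library.Multiset"
begin

section \<open>Groups given by generators and relations\<close>

text \<open>
  The letter \<open>(s, True)\<close> stands for the generator \<open>s\<close>, and \<open>(s, False)\<close> for its formal inverse.
\<close>

type_synonym 'a gword = "('a \<times> bool) list"

text \<open>
  \<open>pres_eq S R\<close> is the smallest congruence on the monoid of words over \<open>S\<close> and its formal inverses
  that contains all pairs in \<open>R\<close> and makes \<open>(s, True)\<close> and \<open>(s, False)\<close> mutually inverse.
  A pair \<open>(u, v)\<close> in \<open>R\<close> stands for the relation \<open>u = v\<close>; both sides should be words over \<open>S\<close>.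
\<close>

inductive pres_eq :: "'a set \<Rightarrow> ('a gword \<times> 'a gword) set \<Rightarrow> 'a gword \<Rightarrow> 'a gword \<Rightarrow> bool"
  for S :: "'a set" and R :: "('a gword \<times> 'a gword) set"
where
  refl: "w \<in> lists (S \<times> UNIV) \<Longrightarrow> pres_eq S R w w"
| sym: "pres_eq S R u v \<Longrightarrow> pres_eq S R v u"
| trans: "pres_eq S R u v \<Longrightarrow> pres_eq S R v w \<Longrightarrow> pres_eq S R u w"
| append: "pres_eq S R u v \<Longrightarrow> pres_eq S R u' v' \<Longrightarrow> pres_eq S R (u @ u') (v @ v')"
| cancel: "s \<in> S \<Longrightarrow> pres_eq S R [(s, b), (s, \<not> b)] []"
| relation: "(u, v) \<in> R \<Longrightarrow> pres_eq S R u v"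

definition pres_class :: "'a set \<Rightarrow> ('a gword \<times> 'a gword) set \<Rightarrow> 'a gword \<Rightarrow> 'a gword set" where
  "pres_class S R w = {v. pres_eq S R w v}"

definition presented_group ::
    "'a set \<Rightarrow> ('a gword \<times> 'a gword) set \<Rightarrow> 'a gword set monoid" where
  "presented_group S R =
     \<lparr>carrier = pres_class S R ` lists (S \<times> UNIV),
      monoid.mult = (\<lambda>A B. \<Union>u\<in>A. \<Union>v\<in>B. pres_class S R (u @ v)),
      one = pres_class S R []\<rparr>"

lemma pres_class_eq_iff:
  assumes "v \<in> lists (S \<times> UNIV)"
  shows "pres_class S R u = pres_class S R v \<longleftrightarrow> pres_eq S R u v"
proof
  assume "pres_class S R u = pres_class S R v"
  with pres_eq.refl[OF assms] show "pres_eq S R u v" unfolding pres_class_def by blast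
next
  assume "pres_eq S R u v"
  then show "pres_class S R u = pres_class S R v"
    unfolding pres_class_def by (blast intro: pres_eq.sym pres_eq.trans)
qed

lemma mult_pres_class:
  assumes "u \<in> lists (S \<times> UNIV)" "v \<in> lists (S \<times> UNIV)"
  shows "pres_class S R u \<otimes>\<^bsub>presented_group S R\<^esub> pres_class S R v = pres_class S R (u @ v)"
proof -
  let ?c = "pres_class S R"
  have eq: "?c (u' @ v') = ?c (u @ v)" if "u' \<in> ?c u" "v' \<in> ?c v" for u' v'
  proof -
    have "pres_eq S R (u @ v) (u' @ v')"
      using that unfolding pres_class_def by (simp add: pres_eq.append)
    then show ?thesis
      unfolding pres_class_def by (blast intro: pres_eq.sym pres_eq.trans)
  qed
  have "u \<in> ?c u" "v \<in> ?c v"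
    using assms by (simp_all add: pres_class_def pres_eq.refl)
  then have ne: "?c u \<noteq> {}" "?c v \<noteq> {}" by blast+
  have "?c u \<otimes>\<^bsub>presented_group S R\<^esub> ?c v = (\<Union>u'\<in>?c u. \<Union>v'\<in>?c v. ?c (u' @ v'))"
    by (simp add: presented_group_def)
  also have "\<dots> = (\<Union>u'\<in>?c u. \<Union>v'\<in>?c v. ?c (u @ v))"
    by (intro SUP_cong HOL.refl eq)
  also have "\<dots> = ?c (u @ v)" using ne by simp
  finally show ?thesis .
qed

lemma pres_eq_inverse_word:
  assumes "w \<in> lists (S \<times> UNIV)"
  shows "pres_eq S R (rev (map (\<lambda>(s, b). (s, \<not> b)) w) @ w) []"
  using assms
proof (induction w rule: lists.induct)
  case Nil
  then show ?case by (simp add: pres_eq.refl)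
next
  case (Cons x w)
  obtain s b where x: "x = (s, b)" by (cases x)
  let ?w' = "rev (map (\<lambda>(s, b). (s, \<not> b)) w)"
  have s: "s \<in> S" and w: "w \<in> lists (S \<times> UNIV)"
    using Cons.hyps unfolding x by simp_all
  have w': "?w' \<in> lists (S \<times> UNIV)" using w by (auto simp: in_lists_conv_set)
  have "pres_eq S R [(s, \<not> b), (s, b)] []"
    using pres_eq.cancel[OF s, of R "\<not> b"] by simp
  from pres_eq.append[OF pres_eq.refl[OF w'] pres_eq.append[OF this pres_eq.refl[OF w]]]
  have "pres_eq S R (rev (map (\<lambda>(s, b). (s, \<not> b)) (x # w)) @ x # w) (?w' @ w)"
    by (simp add: x)
  then show ?case using Cons.IH by (rule pres_eq.trans)
qed

lemma group_presented_group: "group (presented_group S R)"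
proof (rule groupI)
  let ?G = "presented_group S R"
  have carr: "carrier ?G = pres_class S R ` lists (S \<times> UNIV)"
    and one: "\<one>\<^bsub>?G\<^esub> = pres_class S R []"
    by (simp_all add: presented_group_def)
  show "\<one>\<^bsub>?G\<^esub> \<in> carrier ?G" unfolding carr one by blast
  fix x assume x: "x \<in> carrier ?G"
  then obtain u where u: "u \<in> lists (S \<times> UNIV)" "x = pres_class S R u" unfolding carr by blast
  show "\<one>\<^bsub>?G\<^esub> \<otimes>\<^bsub>?G\<^esub> x = x" using u(1) by (simp only: one u(2) mult_pres_class lists.Nil append_Nil)
  fix y assume "y \<in> carrier ?G"
  then obtain v where v: "v \<in> lists (S \<times> UNIV)" "y = pres_class S R v" unfolding carr by blast
  have uv: "u @ v \<in> lists (S \<times> UNIV)" using u(1) v(1) by (simp only: append_in_lists_conv)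
  show "x \<otimes>\<^bsub>?G\<^esub> y \<in> carrier ?G"
    unfolding u(2) v(2) mult_pres_class[OF u(1) v(1)] carr using uv by (rule imageI)
  fix z assume "z \<in> carrier ?G"
  then obtain w where w: "w \<in> lists (S \<times> UNIV)" "z = pres_class S R w" unfolding carr by blast
  have vw: "v @ w \<in> lists (S \<times> UNIV)" using v(1) w(1) by (simp only: append_in_lists_conv)
  show "x \<otimes>\<^bsub>?G\<^esub> y \<otimes>\<^bsub>?G\<^esub> z = x \<otimes>\<^bsub>?G\<^esub> (y \<otimes>\<^bsub>?G\<^esub> z)"
    unfolding u(2) v(2) w(2) using u(1) v(1) w(1) uv vw
    by (simp only: mult_pres_class append_assoc)
next
  let ?G = "presented_group S R"
  have carr: "carrier ?G = pres_class S R ` lists (S \<times> UNIV)"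
    and one: "\<one>\<^bsub>?G\<^esub> = pres_class S R []"
    by (simp_all add: presented_group_def)
  show "\<exists>y\<in>carrier ?G. y \<otimes>\<^bsub>?G\<^esub> x = \<one>\<^bsub>?G\<^esub>" if x: "x \<in> carrier ?G" for x
  proof -
    obtain w where w: "w \<in> lists (S \<times> UNIV)" and xw: "x = pres_class S R w"
      using x unfolding carr by auto
    let ?w' = "rev (map (\<lambda>(s, b). (s, \<not> b)) w)"
    have w': "?w' \<in> lists (S \<times> UNIV)" using w by (auto simp: in_lists_conv_set)
    have "pres_class S R ?w' \<otimes>\<^bsub>?G\<^esub> x = \<one>\<^bsub>?G\<^esub>"
      unfolding xw one mult_pres_class[OF w' w]
      using pres_eq_inverse_word[OF w] by (simp add: pres_class_eq_iff)
    with w' show ?thesis unfolding carr by blast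
  qed
qed

section \<open>Artin groups and Coxeter groups\<close>

text \<open>Labels are extended naturals; the diagonal values \<open>m s s\<close> are never used.\<close>

definition labelling :: "'a set \<Rightarrow> ('a \<Rightarrow> 'a \<Rightarrow> enat) \<Rightarrow> bool" where
  "labelling S m \<longleftrightarrow> (\<forall>s\<in>S. \<forall>t\<in>S. s \<noteq> t \<longrightarrow> m s t = m t s \<and> 2 \<le> m s t)"

text \<open>The alternating word \<open>s t s \<dots>\<close> with \<open>n\<close> letters.\<close>

definition alt_word :: "nat \<Rightarrow> 'a \<Rightarrow> 'a \<Rightarrow> 'a gword" where
  "alt_word n s t = map (\<lambda>i. (if even i then s else t, True)) [0..<n]"

definition braid_relations :: "'a set \<Rightarrow> ('a \<Rightarrow> 'a \<Rightarrow> enat) \<Rightarrow> ('a gword \<times> 'a gword) set" where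
  "braid_relations S m =
     {(alt_word n s t, alt_word n t s) | n s t. s \<in> S \<and> t \<in> S \<and> s \<noteq> t \<and> m s t = enat n}"

definition artin_group :: "'a set \<Rightarrow> ('a \<Rightarrow> 'a \<Rightarrow> enat) \<Rightarrow> 'a gword set monoid" where
  "artin_group S m = presented_group S (braid_relations S m)"

text \<open>The image of the generator \<open>s\<close> in the Artin group.\<close>

definition artin_gen :: "'a set \<Rightarrow> ('a \<Rightarrow> 'a \<Rightarrow> enat) \<Rightarrow> 'a \<Rightarrow> 'a gword set" where
  "artin_gen S m s = pres_class S (braid_relations S m) [(s, True)]"

text \<open>
  The quotient of the Artin group by the relations \<open>s\<^sup>2 = 1\<close>, i.e. these relations are added to
  the presentation.
\<close>

definition coxeter_group :: "'a set \<Rightarrow> ('a \<Rightarrow> 'a \<Rightarrow> enat) \<Rightarrow> 'a gword set monoid" where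
  "coxeter_group S m =
     presented_group S (braid_relations S m \<union> {([(s, True), (s, True)], []) | s. s \<in> S})"

definition spherical_type :: "'a set \<Rightarrow> ('a \<Rightarrow> 'a \<Rightarrow> enat) \<Rightarrow> bool" where
  "spherical_type S m \<longleftrightarrow> finite (carrier (coxeter_group S m))"

definition FC_type :: "'a set \<Rightarrow> ('a \<Rightarrow> 'a \<Rightarrow> enat) \<Rightarrow> bool" where
  "FC_type S m \<longleftrightarrow>
     (\<forall>T\<subseteq>S. (\<forall>s\<in>T. \<forall>t\<in>T. s \<noteq> t \<longrightarrow> m s t \<noteq> \<infinity>) \<longrightarrow> spherical_type T m)"

section \<open>Retractions to standard parabolic subgroups\<close>

definition std_parabolic ::
    "'a set \<Rightarrow> ('a \<Rightarrow> 'a \<Rightarrow> enat) \<Rightarrow> 'a set \<Rightarrow> 'a gword set set" where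
  "std_parabolic S m Y = generate (artin_group S m) (artin_gen S m ` Y)"

definition retraction_to :: "('g, 'b) monoid_scheme \<Rightarrow> 'g set \<Rightarrow> ('g \<Rightarrow> 'g) \<Rightarrow> bool" where
  "retraction_to G H \<rho> \<longleftrightarrow> \<rho> \<in> hom G (G\<lparr>carrier := H\<rparr>) \<and> (\<forall>h\<in>H. \<rho> h = h)"

definition admits_parabolic_retractions :: "'a set \<Rightarrow> ('a \<Rightarrow> 'a \<Rightarrow> enat) \<Rightarrow> bool" where
  "admits_parabolic_retractions S m \<longleftrightarrow>
     (\<forall>Y\<subseteq>S. \<exists>\<rho>. retraction_to (artin_group S m) (std_parabolic S m Y) \<rho>)"

definition odd_label :: "enat \<Rightarrow> bool" where
  "odd_label l \<longleftrightarrow> (\<exists>n. l = enat n \<and> odd n)"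

text \<open>Multisets express that the three labels form the triple in some order.\<close>

definition admissible_triple :: "enat \<Rightarrow> enat \<Rightarrow> enat \<Rightarrow> bool" where
  "admissible_triple p q r \<longleftrightarrow>
     (\<exists>k\<ge>2. {#p, q, r#} = {#2, 2, k#}) \<or>
     (\<exists>i j :: nat. i > 0 \<and> j > 0 \<and> {#p, q, r#} = {#enat (2 * i), enat (2 * j), \<infinity>#}) \<or>
     (\<exists>k\<ge>2. {#p, q, r#} = {#k, \<infinity>, \<infinity>#})"

text \<open>
  The prescribed values of \<open>\<rho>\<^sub>Y\<close> on generators. The second case is meaningful only if the
  element \<open>a\<close> is unique.
\<close>

definition rho_gen ::
    "'a set \<Rightarrow> ('a \<Rightarrow> 'a \<Rightarrow> enat) \<Rightarrow> 'a set \<Rightarrow> 'a \<Rightarrow> 'a gword set" where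
  "rho_gen S m Y v =
     (if v \<in> Y then artin_gen S m v
      else if \<exists>a\<in>Y. odd_label (m v a)
        then artin_gen S m (THE a. a \<in> Y \<and> odd_label (m v a))
      else \<one>\<^bsub>artin_group S m\<^esub>)"

end

theory Submission
  imports Defs "HOL-Algebra.Multiplicative_Group" Complex_Main
begin

text \<open>
  If all triples are admissible, the braid relations can be checked on the prescribed values: an odd
  label \<open>m v a\<close> together with a further finite label at \<open>v\<close> forces the type \<open>(2, 2, k)\<close>, so
  the two values attached to an edge coincide, commute, or both are the original generators.

  Conversely, the Coxeter group already obstructs the bad triples. Let \<open>m s t = p\<close> be odd,
  \<open>m t r = q\<close> be finite, and \<open>M = m s r\<close> be infinite or coprime to \<open>p\<close>. A retraction to the subgroup
  of \<open>{s, r}\<close> sends \<open>t\<close> to an element whose image in the dihedral group of order \<open>2 M\<close> must be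
  \<open>s\<close>, and then the relation between \<open>t\<close> and \<open>r\<close> makes \<open>M\<close> divide \<open>q\<close>. This excludes the
  types \<open>(2, 3, 3)\<close>, \<open>(2, 3, 4)\<close>, \<open>(2, 3, 5)\<close>, and \<open>(p, q, \<infinity>)\<close> with \<open>p\<close> odd. The remaining
  triples of finite labels do not occur in FC type: averaging shows that the cosine form of a
  finite, irreducible Coxeter group is positive definite.
\<close>

section \<open>Alternating products and groups generated by two involutions\<close>

primrec alt_prod :: "('g, 'b) monoid_scheme \<Rightarrow> nat \<Rightarrow> 'g \<Rightarrow> 'g \<Rightarrow> 'g" where
  "alt_prod G 0 x y = \<one>\<^bsub>G\<^esub>"
| "alt_prod G (Suc n) x y = x \<otimes>\<^bsub>G\<^esub> alt_prod G n y x"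

context group
begin

lemma alt_prod_closed [simp, intro]:
  "x \<in> carrier G \<Longrightarrow> y \<in> carrier G \<Longrightarrow> alt_prod G n x y \<in> carrier G"
  by (induction n arbitrary: x y) auto

lemma alt_prod_even:
  assumes "x \<in> carrier G" "y \<in> carrier G"
  shows "alt_prod G (2 * j) x y = (x \<otimes> y) [^] j"
proof (induction j)
  case (Suc j)
  have "alt_prod G (2 * Suc j) x y = (x \<otimes> y) \<otimes> alt_prod G (2 * j) x y"
    using assms by (simp add: m_assoc)
  then show ?case unfolding Suc.IH using assms by (simp only: nat_pow_Suc2 m_closed)
qed simp

lemma alt_prod_commute:
  assumes "x \<in> carrier G" "y \<in> carrier G" "x \<otimes> y = y \<otimes> x" "even n"
  shows "alt_prod G n x y = alt_prod G n y x"
  using assms by (metis alt_prod_even evenE)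

text \<open>Both sides spell the word \<open>x y x ... x\<close> with \<open>2 * j + 1\<close>
  letters; this turns an odd braid relation into a conjugacy relation.\<close>

lemma pow_mult_shift:
  fixes j :: nat
  assumes "x \<in> carrier G" "y \<in> carrier G"
  shows "x \<otimes> (y \<otimes> x) [^] j = (x \<otimes> y) [^] j \<otimes> x"
proof (induction j)
  case (Suc j)
  have "x \<otimes> (y \<otimes> x) [^] Suc j = (x \<otimes> (y \<otimes> x) [^] j) \<otimes> (y \<otimes> x)"
    using assms by (simp add: m_assoc)
  then show ?case unfolding Suc.IH using assms by (simp add: m_assoc)
qed (use assms in simp)

text \<open>For odd \<open>n\<close>, the braid relation of length \<open>n\<close> makes \<open>y\<close> a conjugate of \<open>x\<close>.\<close>

lemma odd_braid_involution:
  assumes x: "x \<in> carrier G" and y: "y \<in> carrier G" and xx: "x \<otimes> x = \<one>"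
    and n: "odd n" and braid: "alt_prod G n x y = alt_prod G n y x"
  shows "y \<otimes> y = \<one>"
proof -
  obtain j where j: "n = Suc (2 * j)" using n by (metis oddE Suc_eq_plus1)
  let ?g = "(x \<otimes> y) [^] j"
  have g: "?g \<in> carrier G" using x y by simp
  have "?g \<otimes> x = y \<otimes> ?g"
    using braid x y unfolding j by (simp add: alt_prod_even pow_mult_shift)
  then have y_eq: "y = ?g \<otimes> x \<otimes> inv ?g"
    using g x y by (simp add: m_assoc)
  have cancel: "inv ?g \<otimes> (?g \<otimes> u) = u" if "u \<in> carrier G" for u
    using g that by (simp flip: m_assoc)
  have "y \<otimes> y = ?g \<otimes> (x \<otimes> (x \<otimes> inv ?g))"
    using g x by (subst (1 2) y_eq) (simp add: m_assoc cancel del: nat_pow_Suc)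
  also have "\<dots> = ?g \<otimes> ((x \<otimes> x) \<otimes> inv ?g)" using g x by (simp add: m_assoc)
  also have "\<dots> = \<one>" using g by (simp add: xx)
  finally show ?thesis .
qed

section \<open>Dihedral groups: products of two involutions\<close>

lemma involution_inv: "x \<in> carrier G \<Longrightarrow> x \<otimes> x = \<one> \<Longrightarrow> inv x = x"
  by (rule inv_equality)

lemma involution_cancel:
  "x \<in> carrier G \<Longrightarrow> x \<otimes> x = \<one> \<Longrightarrow> y \<in> carrier G \<Longrightarrow> x \<otimes> (x \<otimes> y) = y"
  by (simp flip: m_assoc)

lemma involutions_inv_mult:
  assumes "x \<in> carrier G" "y \<in> carrier G" "x \<otimes> x = \<one>" "y \<otimes> y = \<one>"
  shows "inv (x \<otimes> y) = y \<otimes> x"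
  using assms by (simp add: inv_mult_group involution_inv)

text \<open>Conjugation by \<open>x\<close> turns \<open>x y\<close> into its inverse
  \<open>y x\<close>. Integer exponents let one formula cover both directions.\<close>

lemma involutions_conj_pow:
  fixes k :: int
  assumes x: "x \<in> carrier G" and y: "y \<in> carrier G" and xx: "x \<otimes> x = \<one>" and yy: "y \<otimes> y = \<one>"
  shows "x \<otimes> (x \<otimes> y) [^] k = (x \<otimes> y) [^] (- k) \<otimes> x"
proof -
  have nat: "x \<otimes> (x \<otimes> y) [^] j = (y \<otimes> x) [^] j \<otimes> x" for j :: nat
  proof (induction j)
    case (Suc j)
    have "x \<otimes> (x \<otimes> y) [^] Suc j = (x \<otimes> (x \<otimes> y) [^] j) \<otimes> (x \<otimes> y)"
      using x y by (simp add: m_assoc)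
    then show ?case unfolding Suc.IH using x y by (simp add: m_assoc xx involution_cancel[OF x xx])
  qed (use x in simp)
  have nat': "x \<otimes> (y \<otimes> x) [^] j = (x \<otimes> y) [^] j \<otimes> x" for j :: nat
    using pow_mult_shift[OF x y] .
  have inv_c: "inv (x \<otimes> y) = y \<otimes> x" using involutions_inv_mult[OF x y xx yy] .
  have neg: "(x \<otimes> y) [^] (- int j) = (y \<otimes> x) [^] j" for j
    using x y by (simp add: int_pow_neg int_pow_int inv_c flip: nat_pow_inv)
  show ?thesis
  proof (cases k rule: int_cases2)
    case (nonneg j)
    then show ?thesis using nat[of j] neg[of j] by (simp add: int_pow_int)
  next
    case (nonpos j)
    then show ?thesis using nat'[of j] neg[of j] by (simp add: int_pow_int)
  qed
qed

text \<open>The two alternating words differ by a power of the rotation \<open>x y\<close>: moving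
  \<open>x\<close> past a power inverts it, and each new letter supplies one more factor.\<close>

lemma alt_prod_involutions:
  assumes x: "x \<in> carrier G" and y: "y \<in> carrier G" and xx: "x \<otimes> x = \<one>" and yy: "y \<otimes> y = \<one>"
  shows "alt_prod G n x y = (x \<otimes> y) [^] n \<otimes> alt_prod G n y x"
proof (induction n)
  case (Suc n)
  let ?c = "x \<otimes> y" and ?X = "alt_prod G n x y" and ?Y = "alt_prod G n y x"
  have c: "?c \<in> carrier G" and X: "?X \<in> carrier G" and Y: "?Y \<in> carrier G" using x y by auto
  have "?Y = ?c [^] (- int n) \<otimes> ?X"
    using Suc.IH c X Y by (simp add: int_pow_neg int_pow_int inv_solve_left)
  then have "x \<otimes> ?Y = (x \<otimes> ?c [^] (- int n)) \<otimes> ?X"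
    using x c X by (simp add: m_assoc)
  also have "\<dots> = ?c [^] n \<otimes> (x \<otimes> ?X)"
    using x c X by (simp add: involutions_conj_pow[OF x y xx yy] int_pow_int m_assoc)
  also have "x \<otimes> ?X = ?c \<otimes> (y \<otimes> ?X)"
    using x y X by (simp add: m_assoc involution_cancel[OF y yy])
  finally show ?case using x y c X by (simp add: m_assoc)
qed (use x y in simp)

text \<open>Cancelling the common factor leaves that the \<open>n\<close>-th power of
  \<open>x y\<close> is trivial. An infinite order is encoded as \<open>ord = 0\<close>, which
  divides only \<open>n = 0\<close>.\<close>

lemma braid_iff_ord_dvd:
  assumes x: "x \<in> carrier G" and y: "y \<in> carrier G" and "x \<otimes> x = \<one>" and "y \<otimes> y = \<one>"
  shows "alt_prod G n x y = alt_prod G n y x \<longleftrightarrow> ord (x \<otimes> y) dvd n"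
proof -
  have "alt_prod G n x y = alt_prod G n y x \<longleftrightarrow>
      (x \<otimes> y) [^] n \<otimes> alt_prod G n y x = alt_prod G n y x"
    using alt_prod_involutions[OF assms, of n] by simp
  also have "\<dots> \<longleftrightarrow> (x \<otimes> y) [^] n = \<one>"
    using x y by simp
  finally show ?thesis using x y by (simp add: pow_eq_id)
qed

text \<open>In any product of generators, \<open>x\<close> can be moved to the right of every power
  of \<open>x y\<close>, where its square cancels.\<close>

lemma dihedral_cases:
  assumes x: "x \<in> carrier G" and y: "y \<in> carrier G" and xx: "x \<otimes> x = \<one>" and yy: "y \<otimes> y = \<one>"
    and z: "z \<in> generate G {x, y}"
  shows "\<exists>k::int. z = (x \<otimes> y) [^] k \<or> z = (x \<otimes> y) [^] k \<otimes> x"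
proof -
  let ?c = "x \<otimes> y"
  have c: "?c \<in> carrier G" using x y by simp
  have "?c [^] (-1::int) = y \<otimes> x"
    using c int_pow_neg[of ?c 1] by (simp only: int_pow_1 involutions_inv_mult[OF x y xx yy])
  then have y_eq: "y = ?c [^] (-1::int) \<otimes> x"
    using x y by (simp only: m_assoc xx r_one)
  note conj = involutions_conj_pow[OF x y xx yy]
  have gens: "\<exists>k::int. u = ?c [^] k \<otimes> x" if "u \<in> {x, y}" for u
  proof -
    have "x = ?c [^] (0::int) \<otimes> x" using x by simp
    with y_eq that show ?thesis by blast
  qed
  show ?thesis using z
  proof (induction z rule: generate.induct)
    case one
    then show ?case by (metis int_pow_0)
  next
    case (incl u)
    then show ?case using gens by blast
  next
    case (inv u)
    then have "inv u = u" using x y xx yy by (auto simp: involution_inv)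
    then show ?case using gens inv by metis
  next
    case (eng u v)
    then obtain k l :: int where
      k: "u = ?c [^] k \<or> u = ?c [^] k \<otimes> x" and l: "v = ?c [^] l \<or> v = ?c [^] l \<otimes> x" by blast
    have diff: "?c [^] k \<otimes> ?c [^] (- l) = ?c [^] (k - l)"
      using int_pow_mult[OF c, of k "- l"] by simp
    have 1: "?c [^] k \<otimes> x \<otimes> ?c [^] l = ?c [^] (k - l) \<otimes> x"
    proof -
      have "?c [^] k \<otimes> x \<otimes> ?c [^] l = ?c [^] k \<otimes> (?c [^] (- l) \<otimes> x)"
        using x c conj[of l] by (simp add: m_assoc)
      then show ?thesis using x c diff by (simp flip: m_assoc)
    qed
    have 2: "?c [^] k \<otimes> x \<otimes> (?c [^] l \<otimes> x) = ?c [^] (k - l)"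
    proof -
      have "?c [^] k \<otimes> x \<otimes> (?c [^] l \<otimes> x) = (?c [^] k \<otimes> x \<otimes> ?c [^] l) \<otimes> x"
        using x c by (simp add: m_assoc)
      then show ?thesis unfolding 1 using x c by (simp add: m_assoc xx)
    qed
    have 3: "?c [^] k \<otimes> ?c [^] l = ?c [^] (k + l)"
      using c by (simp add: int_pow_mult)
    have 4: "?c [^] k \<otimes> (?c [^] l \<otimes> x) = ?c [^] (k + l) \<otimes> x"
      using x c by (simp add: m_assoc[symmetric] int_pow_mult)
    show ?case using k l 1 2 3 4 by metis
  qed
qed

text \<open>
  If \<open>z\<close> is a rotation, it is an involution commuting with \<open>x\<close>, so the odd braid relation
  degenerates to \<open>x = z\<close>; if \<open>z\<close> is a reflection, the relation forces \<open>x z\<close>, a power of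
  \<open>x y\<close>, to have order dividing \<open>p\<close>.
\<close>

lemma dihedral_odd_braid:
  assumes x: "x \<in> carrier G" and y: "y \<in> carrier G" and xx: "x \<otimes> x = \<one>" and yy: "y \<otimes> y = \<one>"
    and z: "z \<in> generate G {x, y}"
    and p: "odd p" "ord (x \<otimes> y) = 0 \<or> coprime p (ord (x \<otimes> y))"
    and braid: "alt_prod G p x z = alt_prod G p z x"
  shows "z = x"
proof -
  let ?c = "x \<otimes> y"
  have c: "?c \<in> carrier G" using x y by simp
  have zc: "z \<in> carrier G" using z x y generate_in_carrier[of "{x, y}"] by auto
  have zz: "z \<otimes> z = \<one>" by (rule odd_braid_involution[OF x zc xx p(1) braid])
  have "ord (x \<otimes> z) dvd p" using braid_iff_ord_dvd[OF x zc xx zz] braid by simp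
  then have pow: "(x \<otimes> z) [^] p = \<one>" using x zc by (simp add: pow_eq_id)
  note conj = involutions_conj_pow[OF x y xx yy]
  have "x \<otimes> z = \<one>"
  proof -
    obtain k :: int where "z = ?c [^] k \<or> z = ?c [^] k \<otimes> x"
      using dihedral_cases[OF x y xx yy z] by blast
    then show ?thesis
    proof
      assume k: "z = ?c [^] k"
      have "inv z = z" using zc zz by (rule involution_inv)
      then have "?c [^] (- k) = z" using k c by (simp add: int_pow_neg)
      then have comm: "x \<otimes> z = z \<otimes> x" using conj[of k] k by simp
      obtain j where j: "p = Suc (2 * j)" using p by (metis oddE Suc_eq_plus1)
      \<comment> \<open>The product of two commuting involutions has trivial square, so its odd
        power \<open>p\<close> is the product itself.\<close>
      have "(x \<otimes> z) \<otimes> (x \<otimes> z) = (z \<otimes> x) \<otimes> (x \<otimes> z)" by (simp add: comm)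
      also have "\<dots> = \<one>" using x zc by (simp add: m_assoc involution_cancel[OF x xx] zz)
      finally have "(x \<otimes> z) [^] (2::nat) = \<one>"
        using x zc by (simp add: numeral_2_eq_2)
      then have "(x \<otimes> z) [^] (2 * j) = \<one>"
        using x zc by (metis nat_pow_pow nat_pow_one m_closed)
      then show ?thesis using pow x zc by (simp add: j)
    next
      assume k: "z = ?c [^] k \<otimes> x"
      have xz: "x \<otimes> z = ?c [^] (- k)"
        using conj[of k] x c by (simp add: k m_assoc[symmetric] xx) (simp add: m_assoc xx)
      have "?c [^] (- k * int p) = \<one>"
        using pow c unfolding xz by (metis int_pow_int int_pow_pow)
      then have "int (ord ?c) dvd - k * int p" using c int_pow_eq_id by blast
      \<comment> \<open>If the order is 0, the divisibility forces \<open>k * p = 0\<close>, hence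
        \<open>k = 0\<close> because an odd \<open>p\<close> is positive.\<close>
      moreover have "k = 0 \<or> coprime (int p) (int (ord ?c))"
        if "int (ord ?c) dvd - k * int p" using that p odd_pos[OF p(1)] by auto
      ultimately have "int (ord ?c) dvd k"
        by (metis coprime_commute coprime_dvd_mult_left_iff dvd_0_right dvd_minus_iff minus_mult_left)
      then have "?c [^] (- k) = \<one>" using c by (simp add: int_pow_eq_id)
      then show ?thesis by (simp add: xz)
    qed
  qed
  then show ?thesis using x zc xx involution_inv inv_equality inv_comm by metis
qed

end

section \<open>Homomorphisms out of presented groups\<close>

definition letter_eval :: "('g, 'b) monoid_scheme \<Rightarrow> ('a \<Rightarrow> 'g) \<Rightarrow> 'a \<times> bool \<Rightarrow> 'g" where
  "letter_eval H f = (\<lambda>(s, b). if b then f s else inv\<^bsub>H\<^esub> f s)"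

definition word_eval :: "('g, 'b) monoid_scheme \<Rightarrow> ('a \<Rightarrow> 'g) \<Rightarrow> 'a gword \<Rightarrow> 'g" where
  "word_eval H f w = foldr (\<lambda>x y. letter_eval H f x \<otimes>\<^bsub>H\<^esub> y) w \<one>\<^bsub>H\<^esub>"

lemma word_eval_simps [simp]:
  "word_eval H f [] = \<one>\<^bsub>H\<^esub>"
  "word_eval H f (x # w) = letter_eval H f x \<otimes>\<^bsub>H\<^esub> word_eval H f w"
  by (simp_all add: word_eval_def)

lemma alt_word_0: "alt_word 0 s t = []"
  by (simp add: alt_word_def)

lemma alt_word_Suc: "alt_word (Suc n) s t = (s, True) # alt_word n t s"
proof -
  have "[0..<Suc n] = 0 # map Suc [0..<n]" by (simp only: map_Suc_upt upt_conv_Cons[OF zero_less_Suc])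
  then show ?thesis by (auto simp: alt_word_def simp del: upt_Suc map_Suc_upt)
qed

lemma word_eval_alt_word: "word_eval H f (alt_word n s t) = alt_prod H n (f s) (f t)"
  by (induction n arbitrary: s t) (simp_all add: alt_word_0 alt_word_Suc letter_eval_def)

lemma alt_word_in_lists: "s \<in> S \<Longrightarrow> t \<in> S \<Longrightarrow> alt_word n s t \<in> lists (S \<times> UNIV)"
  by (auto simp: alt_word_def)

lemma pres_class_closed:
  "w \<in> lists (S \<times> UNIV) \<Longrightarrow> pres_class S R w \<in> carrier (presented_group S R)"
  by (simp add: presented_group_def del: in_lists_conv_set)

lemma braid_relations_in_lists:
  assumes "(u, v) \<in> braid_relations S m"
  shows "u \<in> lists (S \<times> UNIV) \<and> v \<in> lists (S \<times> UNIV)"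
proof -
  obtain n s t where "u = alt_word n s t" "v = alt_word n t s" "s \<in> S" "t \<in> S"
    using assms unfolding braid_relations_def by blast
  then show ?thesis by (simp only: alt_word_in_lists)
qed

context group
begin

lemma letter_eval_closed:
  assumes "f ` S \<subseteq> carrier G" "x \<in> S \<times> UNIV"
  shows "letter_eval G f x \<in> carrier G"
  using assms by (auto simp: letter_eval_def)

lemma word_eval_closed:
  assumes "f ` S \<subseteq> carrier G" "w \<in> lists (S \<times> UNIV)"
  shows "word_eval G f w \<in> carrier G"
  using assms(2) by induction (auto intro: letter_eval_closed[OF assms(1)])

lemma word_eval_append:
  assumes "f ` S \<subseteq> carrier G" "u \<in> lists (S \<times> UNIV)" "v \<in> lists (S \<times> UNIV)"
  shows "word_eval G f (u @ v) = word_eval G f u \<otimes> word_eval G f v"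
  using assms(2)
proof induction
  case (Cons x u)
  then show ?case
    using assms(3) by (simp add: m_assoc word_eval_closed[OF assms(1)] letter_eval_closed[OF assms(1)])
qed (simp add: word_eval_closed[OF assms(1,3)])

text \<open>Induction over the congruence. Membership of both words in
  \<open>lists (S \<times> UNIV)\<close> is carried along because evaluating a concatenation
  requires it.\<close>

lemma word_eval_pres_eq:
  assumes f: "f ` S \<subseteq> carrier G"
    and R: "\<And>u v. (u, v) \<in> R \<Longrightarrow> u \<in> lists (S \<times> UNIV) \<and> v \<in> lists (S \<times> UNIV)"
    and rel: "\<And>u v. (u, v) \<in> R \<Longrightarrow> word_eval G f u = word_eval G f v"
    and eq: "pres_eq S R u v"
  shows "u \<in> lists (S \<times> UNIV) \<and> v \<in> lists (S \<times> UNIV) \<and> word_eval G f u = word_eval G f v"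
  using eq
proof induction
  case (append u v u' v')
  then show ?case using word_eval_append[OF f] by (simp del: in_lists_conv_set)
next
  case (cancel s b)
  then have "f s \<in> carrier G" using f by auto
  then show ?case using cancel by (cases b) (auto simp: letter_eval_def)
next
  case (relation u v)
  then show ?case using R rel by blast
qed auto

text \<open>Von Dyck's theorem. A class is evaluated at a representative picked by
  \<open>SOME\<close>; invariance under \<open>pres_eq\<close> makes the choice immaterial.\<close>

lemma presented_group_hom_exists:
  assumes f: "f ` S \<subseteq> carrier G"
    and R: "\<And>u v. (u, v) \<in> R \<Longrightarrow> u \<in> lists (S \<times> UNIV) \<and> v \<in> lists (S \<times> UNIV)"
    and rel: "\<And>u v. (u, v) \<in> R \<Longrightarrow> word_eval G f u = word_eval G f v"
  shows "\<exists>\<phi> \<in> hom (presented_group S R) G. \<forall>s\<in>S. \<phi> (pres_class S R [(s, True)]) = f s"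
proof -
  define \<phi> where "\<phi> C = word_eval G f (SOME w. w \<in> lists (S \<times> UNIV) \<and> C = pres_class S R w)" for C
  have \<phi>: "\<phi> (pres_class S R w) = word_eval G f w" if w: "w \<in> lists (S \<times> UNIV)" for w
  proof -
    let ?v = "SOME v. v \<in> lists (S \<times> UNIV) \<and> pres_class S R w = pres_class S R v"
    have v: "?v \<in> lists (S \<times> UNIV) \<and> pres_class S R w = pres_class S R ?v"
      by (rule someI[of _ w]) (use w in simp)
    then have "pres_eq S R w ?v" using pres_class_eq_iff by blast
    then have "word_eval G f w = word_eval G f ?v"
      using word_eval_pres_eq[OF f R rel] by blast
    then show ?thesis by (simp add: \<phi>_def)
  qed
  have carr: "carrier (presented_group S R) = pres_class S R ` lists (S \<times> UNIV)"
    by (simp add: presented_group_def)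
  have "\<phi> \<in> hom (presented_group S R) G"
  proof (rule homI)
    fix x assume "x \<in> carrier (presented_group S R)"
    then obtain w where "w \<in> lists (S \<times> UNIV)" "x = pres_class S R w" unfolding carr by blast
    then show "\<phi> x \<in> carrier G" by (simp only: \<phi> word_eval_closed[OF f])
  next
    fix x y assume "x \<in> carrier (presented_group S R)" "y \<in> carrier (presented_group S R)"
    then obtain u v where uv: "u \<in> lists (S \<times> UNIV)" "v \<in> lists (S \<times> UNIV)"
      "x = pres_class S R u" "y = pres_class S R v" unfolding carr by blast
    then have "u @ v \<in> lists (S \<times> UNIV)" by simp
    then show "\<phi> (x \<otimes>\<^bsub>presented_group S R\<^esub> y) = \<phi> x \<otimes> \<phi> y"
      using uv by (simp only: mult_pres_class \<phi> word_eval_append[OF f])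
  qed
  moreover have "\<phi> (pres_class S R [(s, True)]) = f s" if "s \<in> S" for s
    using \<phi>[of "[(s, True)]"] f that by (auto simp: letter_eval_def)
  ultimately show ?thesis by blast
qed

lemma artin_group_hom_exists:
  assumes f: "f ` S \<subseteq> carrier G"
    and braid: "\<And>n s t. s \<in> S \<Longrightarrow> t \<in> S \<Longrightarrow> s \<noteq> t \<Longrightarrow> m s t = enat n \<Longrightarrow>
      alt_prod G n (f s) (f t) = alt_prod G n (f t) (f s)"
  shows "\<exists>\<phi> \<in> hom (artin_group S m) G. \<forall>s\<in>S. \<phi> (artin_gen S m s) = f s"
  unfolding artin_group_def artin_gen_def
proof (rule presented_group_hom_exists[OF f])
  fix u v assume "(u, v) \<in> braid_relations S m"
  then show "word_eval G f u = word_eval G f v"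
    unfolding braid_relations_def using braid by (auto simp: word_eval_alt_word)
qed (use braid_relations_in_lists in blast)

text \<open>The conclusion keeps only that the range contains the values on generators; this is what
  later yields a set of linear maps closed under the reflections.\<close>

lemma coxeter_group_hom_exists:
  assumes f: "f ` S \<subseteq> carrier G"
    and braid: "\<And>n s t. s \<in> S \<Longrightarrow> t \<in> S \<Longrightarrow> s \<noteq> t \<Longrightarrow> m s t = enat n \<Longrightarrow>
      alt_prod G n (f s) (f t) = alt_prod G n (f t) (f s)"
    and sq: "\<And>s. s \<in> S \<Longrightarrow> f s \<otimes> f s = \<one>"
  shows "\<exists>\<phi> \<in> hom (coxeter_group S m) G. \<forall>s\<in>S. f s \<in> \<phi> ` carrier (coxeter_group S m)"
proof -
  let ?R = "braid_relations S m \<union> {([(s, True), (s, True)], []) | s. s \<in> S}"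
  have "\<exists>\<phi> \<in> hom (presented_group S ?R) G. \<forall>s\<in>S. \<phi> (pres_class S ?R [(s, True)]) = f s"
  proof (rule presented_group_hom_exists[OF f], goal_cases)
    case (1 u v)
    then show ?case using braid_relations_in_lists[of u v S m] by auto
  next
    case (2 u v)
    moreover have "f s \<in> carrier G" if "s \<in> S" for s using f that by blast
    ultimately show ?case
      unfolding braid_relations_def using braid sq by (auto simp: word_eval_alt_word letter_eval_def)
  qed
  moreover have "pres_class S ?R [(s, True)] \<in> carrier (coxeter_group S m)" if "s \<in> S" for s
    unfolding coxeter_group_def by (rule pres_class_closed) (simp add: that)
  ultimately show ?thesis unfolding coxeter_group_def by (auto intro!: bexI rev_image_eqI)
qed

end

section \<open>Generators of Artin groups, and retractions given by values on generators\<close>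

lemma group_artin_group: "group (artin_group S m)"
  unfolding artin_group_def by (rule group_presented_group)

lemma group_coxeter_group: "group (coxeter_group S m)"
  unfolding coxeter_group_def by (rule group_presented_group)

lemma artin_gen_closed: "s \<in> S \<Longrightarrow> artin_gen S m s \<in> carrier (artin_group S m)"
  unfolding artin_gen_def artin_group_def by (rule pres_class_closed) simp

lemma artin_gen_braid:
  assumes "s \<in> S" "t \<in> S" "s \<noteq> t" "m s t = enat n"
  shows "alt_prod (artin_group S m) n (artin_gen S m s) (artin_gen S m t) =
    alt_prod (artin_group S m) n (artin_gen S m t) (artin_gen S m s)"
proof -
  let ?R = "braid_relations S m"
  have alt: "alt_prod (artin_group S m) k (artin_gen S m x) (artin_gen S m y) =
      pres_class S ?R (alt_word k x y)" if "x \<in> S" "y \<in> S" for k x y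
    using that
  proof (induction k arbitrary: x y)
    case 0
    then show ?case by (simp add: artin_group_def presented_group_def alt_word_0)
  next
    case (Suc k)
    then have "[(x, True)] \<in> lists (S \<times> UNIV)" "alt_word k y x \<in> lists (S \<times> UNIV)"
      using alt_word_in_lists by simp_all
    from mult_pres_class[OF this] Suc show ?case
      by (simp add: artin_group_def artin_gen_def alt_word_Suc)
  qed
  have "pres_eq S ?R (alt_word n s t) (alt_word n t s)"
    by (rule pres_eq.relation) (use assms in \<open>auto simp: braid_relations_def\<close>)
  then show ?thesis using assms
    by (simp add: alt pres_class_eq_iff[OF alt_word_in_lists])
qed

text \<open>By the cancellation rule, the class of a formal inverse letter is the group inverse of
  the generator; induction over words does the rest.\<close>

lemma artin_group_generated:
  assumes x: "x \<in> carrier (artin_group S m)"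
  shows "x \<in> generate (artin_group S m) (artin_gen S m ` S)"
proof -
  interpret group "artin_group S m" by (rule group_artin_group)
  let ?R = "braid_relations S m" and ?H = "generate (artin_group S m) (artin_gen S m ` S)"
  have letter: "pres_class S ?R [(s, b)] \<in> ?H" if s: "s \<in> S" for s b
  proof (cases b)
    case True
    then show ?thesis using s by (auto simp: artin_gen_def[symmetric] intro: generate.incl)
  next
    case False
    have l: "[(s, False)] \<in> lists (S \<times> UNIV)" "[(s, True)] \<in> lists (S \<times> UNIV)" using s by auto
    have "pres_class S ?R [(s, False)] \<otimes>\<^bsub>artin_group S m\<^esub> artin_gen S m s = \<one>\<^bsub>artin_group S m\<^esub>"
      using mult_pres_class[OF l, of ?R] pres_eq.cancel[OF s, of ?R False]
      by (simp add: artin_gen_def artin_group_def pres_class_eq_iff)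
        (simp add: presented_group_def pres_class_eq_iff)
    moreover have "pres_class S ?R [(s, False)] \<in> carrier (artin_group S m)"
      unfolding artin_group_def by (rule pres_class_closed[OF l(1)])
    ultimately have "inv\<^bsub>artin_group S m\<^esub> artin_gen S m s = pres_class S ?R [(s, False)]"
      by (rule inv_equality[OF _ artin_gen_closed[OF s]])
    then show ?thesis using False s generate.inv[of "artin_gen S m s" "artin_gen S m ` S" "artin_group S m"]
      by simp
  qed
  have "pres_class S ?R w \<in> ?H" if "w \<in> lists (S \<times> UNIV)" for w
    using that
  proof induction
    case Nil
    then show ?case using generate.one[of "artin_group S m"]
      by (simp add: artin_group_def presented_group_def)
  next
    case (Cons a w)
    then obtain s b where a: "a = (s, b)" "s \<in> S" by auto
    then have "[a] \<in> lists (S \<times> UNIV)" by auto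
    from mult_pres_class[OF this Cons.hyps(2), of ?R]
    have "pres_class S ?R (a # w) = pres_class S ?R [a] \<otimes>\<^bsub>artin_group S m\<^esub> pres_class S ?R w"
      by (simp add: artin_group_def)
    then show ?case using letter[OF a(2), of b] Cons.IH a by (simp add: generate.eng)
  qed
  then show ?thesis using x by (auto simp: artin_group_def presented_group_def)
qed

text \<open>The values extend to an endomorphism of the whole group. Induction over
  \<open>generate\<close> puts its image into the parabolic subgroup and shows that it fixes this
  subgroup pointwise.\<close>

lemma retraction_from_generators:
  assumes Y: "Y \<subseteq> S"
    and f: "\<And>s. s \<in> S \<Longrightarrow> f s \<in> std_parabolic S m Y"
    and id: "\<And>s. s \<in> Y \<Longrightarrow> f s = artin_gen S m s"
    and braid: "\<And>n s t. s \<in> S \<Longrightarrow> t \<in> S \<Longrightarrow> s \<noteq> t \<Longrightarrow> m s t = enat n \<Longrightarrow>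
      alt_prod (artin_group S m) n (f s) (f t) = alt_prod (artin_group S m) n (f t) (f s)"
  shows "\<exists>\<rho>. retraction_to (artin_group S m) (std_parabolic S m Y) \<rho> \<and>
    (\<forall>s\<in>S. \<rho> (artin_gen S m s) = f s)"
proof -
  interpret group "artin_group S m" by (rule group_artin_group)
  let ?A = "artin_group S m" and ?H = "std_parabolic S m Y"
  have Ysub: "artin_gen S m ` Y \<subseteq> carrier ?A" using Y by (auto simp: artin_gen_closed)
  have H: "subgroup ?H ?A"
    unfolding std_parabolic_def by (rule generate_is_subgroup[OF Ysub])
  then have "f ` S \<subseteq> carrier ?A" using f subgroup.subset by blast
  from artin_group_hom_exists[OF this braid] obtain \<phi> where
    \<phi>: "\<phi> \<in> hom ?A ?A" "\<forall>s\<in>S. \<phi> (artin_gen S m s) = f s" by blast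
  interpret \<phi>: group_hom ?A ?A \<phi> by unfold_locales (rule \<phi>(1))
  have img: "\<phi> x \<in> ?H" if x: "x \<in> carrier ?A" for x
    using artin_group_generated[OF x]
  proof induction
    case one
    then show ?case using subgroup.one_closed[OF H] by simp
  next
    case (incl h)
    then show ?case using \<phi>(2) f by auto
  next
    case (inv h)
    then show ?case using \<phi>(2) f subgroup.m_inv_closed[OF H] by (auto simp: artin_gen_closed)
  next
    case (eng g h)
    have "artin_gen S m ` S \<subseteq> carrier ?A" by (auto simp: artin_gen_closed)
    then have "g \<in> carrier ?A" "h \<in> carrier ?A"
      using eng.hyps generate_in_carrier by blast+
    then show ?case using subgroup.m_closed[OF H] eng.IH by simp
  qed
  have fix_H: "\<phi> x = x" if "x \<in> ?H" for x
    using that unfolding std_parabolic_def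
  proof induction
    case one
    then show ?case by simp
  next
    case (incl h)
    then show ?case using \<phi>(2) id Y by auto
  next
    case (inv h)
    then show ?case using \<phi>(2) id Y by (auto simp: artin_gen_closed subset_iff)
  next
    case (eng g h)
    then have "g \<in> carrier ?A" "h \<in> carrier ?A"
      using generate_in_carrier[OF Ysub] by blast+
    then show ?case using eng.IH by simp
  qed
  have "\<phi> \<in> hom ?A (?A\<lparr>carrier := ?H\<rparr>)"
    using img by (intro homI) (auto simp: \<phi>.hom_mult)
  then show ?thesis unfolding retraction_to_def using fix_H \<phi>(2) by blast
qed

section \<open>The Tits representation\<close>

text \<open>The representation space is the full type \<open>'a \<Rightarrow> real\<close>, which
  avoids a carrier set for vectors; the reflection at \<open>s\<close> changes only the coordinate
  at \<open>s\<close>.\<close>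

definition lin_op :: "(('a \<Rightarrow> real) \<Rightarrow> 'a \<Rightarrow> real) \<Rightarrow> bool" where
  "lin_op f \<longleftrightarrow> (\<forall>a b u v. f (\<lambda>x. a * u x + b * v x) = (\<lambda>x. a * f u x + b * f v x))"

definition lin_monoid :: "(('a \<Rightarrow> real) \<Rightarrow> 'a \<Rightarrow> real) monoid" where
  "lin_monoid = \<lparr>carrier = {f. lin_op f}, monoid.mult = (\<circ>), one = id\<rparr>"

abbreviation lin_group :: "(('a \<Rightarrow> real) \<Rightarrow> 'a \<Rightarrow> real) monoid" where
  "lin_group \<equiv> units_of lin_monoid"

lemma monoid_lin_monoid: "monoid lin_monoid"
proof -
  have "lin_op (f \<circ> g)" if "lin_op f" "lin_op g" for f g :: "('a \<Rightarrow> real) \<Rightarrow> 'a \<Rightarrow> real"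
    using that by (simp add: lin_op_def)
  then show ?thesis by (intro monoidI) (auto simp: lin_monoid_def lin_op_def)
qed

lemma group_lin_group: "group lin_group"
  by (rule monoid.units_group[OF monoid_lin_monoid])

lemma lin_group_simps [simp]:
  "x \<otimes>\<^bsub>lin_group\<^esub> y = x \<circ> y" "\<one>\<^bsub>lin_group\<^esub> = id"
  by (simp_all add: units_of_def lin_monoid_def)

lemma lin_group_carrierD: "f \<in> carrier lin_group \<Longrightarrow> lin_op f"
  by (simp add: units_of_def Units_def lin_monoid_def)

lemma involution_in_lin_group: "lin_op f \<Longrightarrow> f \<circ> f = id \<Longrightarrow> f \<in> carrier lin_group"
  by (auto simp: units_of_def Units_def lin_monoid_def)

lemma lin_group_pow: "x [^]\<^bsub>lin_group\<^esub> (k::nat) = x ^^ k"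
  by (induction k) (simp_all add: nat_pow_def funpow_Suc_right del: funpow.simps(2))

text \<open>The Gram matrix of the simple roots in the Tits representation. An infinite label gets
  -1, the limit of \<open>- cos (pi / n)\<close>.\<close>

definition cosine :: "('a \<Rightarrow> 'a \<Rightarrow> enat) \<Rightarrow> 'a \<Rightarrow> 'a \<Rightarrow> real" where
  "cosine m s t = (if s = t then 1 else case m s t of enat n \<Rightarrow> - cos (pi / real n) | \<infinity> \<Rightarrow> - 1)"

definition cosine_form :: "'a set \<Rightarrow> ('a \<Rightarrow> 'a \<Rightarrow> enat) \<Rightarrow> 'a \<Rightarrow> ('a \<Rightarrow> real) \<Rightarrow> real" where
  "cosine_form S m s v = (\<Sum>t\<in>S. cosine m s t * v t)"

text \<open>The usual \<open>v - 2 B(e_s, v) e_s\<close>, with \<open>of_bool (x = s)\<close> as the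
  basis vector \<open>e_s\<close> and \<open>cosine_form\<close> as
  \<open>B(e_s, v)\<close>.\<close>

definition reflection :: "'a set \<Rightarrow> ('a \<Rightarrow> 'a \<Rightarrow> enat) \<Rightarrow> 'a \<Rightarrow> ('a \<Rightarrow> real) \<Rightarrow> 'a \<Rightarrow> real" where
  "reflection S m s v = (\<lambda>x. v x - 2 * cosine_form S m s v * of_bool (x = s))"

text \<open>Coordinates along two basis vectors. The base point \<open>u\<close> will be orthogonal
  to both, hence fixed by both reflections.\<close>

definition plane :: "'a \<Rightarrow> 'a \<Rightarrow> ('a \<Rightarrow> real) \<Rightarrow> real \<Rightarrow> real \<Rightarrow> 'a \<Rightarrow> real" where
  "plane s t u \<alpha> \<beta> = (\<lambda>x. u x + \<alpha> * of_bool (x = s) + \<beta> * of_bool (x = t))"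

lemma cosine_self [simp]: "cosine m s s = 1"
  by (simp add: cosine_def)

lemma cosine_form_linear:
  "cosine_form S m s (\<lambda>x. a * u x + b * v x) = a * cosine_form S m s u + b * cosine_form S m s v"
  by (simp add: cosine_form_def sum_distrib_left algebra_simps sum.distrib)

lemma lin_op_reflection: "lin_op (reflection S m s)"
  by (simp add: lin_op_def reflection_def cosine_form_linear algebra_simps fun_eq_iff)

lemma sin_recurrence: "sin (x + \<theta>) = 2 * cos \<theta> * sin x - sin (x - \<theta>)" for x \<theta> :: real
  by (simp add: sin_add sin_diff)

section \<open>Orders of products of two reflections\<close>

locale labelled_set =
  fixes S :: "'a set" and m :: "'a \<Rightarrow> 'a \<Rightarrow> enat"
  assumes finite_S: "finite S" and labelling: "labelling S m"
begin

lemma cosine_commute: "s \<in> S \<Longrightarrow> t \<in> S \<Longrightarrow> cosine m s t = cosine m t s"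
  using labelling by (auto simp: cosine_def labelling_def)

lemma label_ge_2: "s \<in> S \<Longrightarrow> t \<in> S \<Longrightarrow> s \<noteq> t \<Longrightarrow> m s t = enat n \<Longrightarrow> 2 \<le> n"
  using labelling unfolding labelling_def by (metis enat_ord_simps(1) numeral_eq_enat)

lemma cosine_form_plane:
  assumes "s \<in> S" "t \<in> S"
  shows "cosine_form S m r (plane s t u \<alpha> \<beta>) =
    cosine_form S m r u + \<alpha> * cosine m r s + \<beta> * cosine m r t"
  using assms finite_S
  by (simp add: cosine_form_def plane_def algebra_simps sum.distrib of_bool_def
      if_distrib[of "\<lambda>x. _ * x"] sum.delta cong: if_cong)

lemma cosine_form_basis:
  assumes "s \<in> S"
  shows "cosine_form S m r (\<lambda>x. of_bool (x = s)) = cosine m r s"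
  using assms finite_S
  by (simp add: cosine_form_def of_bool_def if_distrib[of "\<lambda>x. _ * x"] sum.delta cong: if_cong)

lemma reflection_involution:
  assumes "s \<in> S"
  shows "reflection S m s \<circ> reflection S m s = id"
proof (rule ext)
  fix v
  have "cosine_form S m s (reflection S m s v) = - cosine_form S m s v"
    using cosine_form_linear[of S m s 1 v "- 2 * cosine_form S m s v" "\<lambda>x. of_bool (x = s)"]
    by (simp add: reflection_def cosine_form_basis[OF assms])
  then show "(reflection S m s \<circ> reflection S m s) v = id v"
    by (subst (1) comp_apply, subst reflection_def) (simp add: reflection_def)
qed

lemma reflection_in_lin_group: "s \<in> S \<Longrightarrow> reflection S m s \<in> carrier lin_group"
  by (intro involution_in_lin_group lin_op_reflection reflection_involution)

lemma rotation_plane: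
  assumes st: "s \<in> S" "t \<in> S" and u: "cosine_form S m s u = 0" "cosine_form S m t u = 0"
  shows "(reflection S m s \<circ> reflection S m t) (plane s t u \<alpha> \<beta>) =
    plane s t u (- \<alpha> - 2 * cosine m s t * (- \<beta> - 2 * cosine m s t * \<alpha>))
      (- \<beta> - 2 * cosine m s t * \<alpha>)"
proof -
  have t: "reflection S m t (plane s t u a b) = plane s t u a (- b - 2 * cosine m s t * a)" for a b
    using u cosine_commute[OF st] unfolding reflection_def cosine_form_plane[OF st]
    by (auto simp: plane_def fun_eq_iff algebra_simps)
  have s: "reflection S m s (plane s t u a b) = plane s t u (- a - 2 * cosine m s t * b) b" for a b
    using u unfolding reflection_def cosine_form_plane[OF st]
    by (auto simp: plane_def fun_eq_iff algebra_simps)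
  show ?thesis by (simp add: s t)
qed

text \<open>The product is a rotation by \<open>2 * \<theta>\<close> in the plane of the two basis
  vectors; its coefficients obey the three-term recurrence of \<open>sin\<close>.\<close>

lemma rotation_pow_plane:
  assumes st: "s \<in> S" "t \<in> S" and u: "cosine_form S m s u = 0" "cosine_form S m t u = 0"
    and c: "cosine m s t = - cos \<theta>" and \<theta>: "sin \<theta> \<noteq> 0"
  shows "((reflection S m s \<circ> reflection S m t) ^^ k) (plane s t u \<alpha> \<beta>) =
    plane s t u ((\<alpha> * sin (2 * real k * \<theta> + \<theta>) - \<beta> * sin (2 * real k * \<theta>)) / sin \<theta>)
      ((\<alpha> * sin (2 * real k * \<theta>) - \<beta> * sin (2 * real k * \<theta> - \<theta>)) / sin \<theta>)"
proof (induction k)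
  case 0
  then show ?case using \<theta> by simp
next
  case (Suc k)
  define x where "x = 2 * real k * \<theta>"
  have x': "2 * real (Suc k) * \<theta> = x + \<theta> + \<theta>" by (simp add: x_def algebra_simps)
  have 1: "sin (x - \<theta>) = 2 * cos \<theta> * sin x - sin (x + \<theta>)" using sin_recurrence[of x \<theta>] by simp
  have 2: "sin (x + \<theta> + \<theta>) = 2 * cos \<theta> * sin (x + \<theta>) - sin x"
    using sin_recurrence[of "x + \<theta>" \<theta>] by simp
  have 3: "sin (x + \<theta> + \<theta> + \<theta>) = 2 * cos \<theta> * sin (x + \<theta> + \<theta>) - sin (x + \<theta>)"
    using sin_recurrence[of "x + \<theta> + \<theta>" \<theta>] by (simp add: algebra_simps)
  define A where "A = (\<alpha> * sin (x + \<theta>) - \<beta> * sin x) / sin \<theta>"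
  define B where "B = (\<alpha> * sin x - \<beta> * sin (x - \<theta>)) / sin \<theta>"
  have B': "- B + 2 * cos \<theta> * A = (\<alpha> * sin (x + \<theta> + \<theta>) - \<beta> * sin (x + \<theta>)) / sin \<theta>"
    unfolding A_def B_def 1 2 using \<theta> by (simp add: field_simps)
  have A': "- A + 2 * cos \<theta> * (- B + 2 * cos \<theta> * A) =
      (\<alpha> * sin (x + \<theta> + \<theta> + \<theta>) - \<beta> * sin (x + \<theta> + \<theta>)) / sin \<theta>"
    unfolding B' unfolding A_def 3 2 using \<theta> by (simp add: field_simps)
  have "((reflection S m s \<circ> reflection S m t) ^^ Suc k) (plane s t u \<alpha> \<beta>) =
      (reflection S m s \<circ> reflection S m t) (plane s t u A B)"
    unfolding funpow.simps(2) comp_apply[of _ "_ ^^ k"] Suc.IH by (simp only: x_def A_def B_def)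
  also have "\<dots> = plane s t u (- A + 2 * cos \<theta> * (- B + 2 * cos \<theta> * A)) (- B + 2 * cos \<theta> * A)"
    unfolding rotation_plane[OF st u] c by (simp add: algebra_simps)
  also note A'
  also note B'
  finally show ?case by (simp only: x' add_diff_cancel_right')
qed

text \<open>Since \<open>sin \<theta>\<close> is nonzero, the form is nondegenerate on the plane, so
  every vector splits into a plane part, which is rotated, and an orthogonal part, which is
  fixed.\<close>

lemma rotation_finite_order:
  assumes st: "s \<in> S" "t \<in> S" "s \<noteq> t" and n: "m s t = enat n"
  shows "(reflection S m s \<circ> reflection S m t) ^^ k = id \<longleftrightarrow> n dvd k"
proof -
  let ?c = "reflection S m s \<circ> reflection S m t"
  define \<theta> where "\<theta> = pi / real n"
  have n2: "2 \<le> n" using label_ge_2[OF st n] .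
  have "0 < \<theta>" "\<theta> < pi" using n2 by (auto simp: \<theta>_def field_simps)
  then have sin: "sin \<theta> > 0" by (rule sin_gt_zero)
  have c: "cosine m s t = - cos \<theta>" using st n by (simp add: cosine_def \<theta>_def)
  note pow = rotation_pow_plane[OF st(1,2) _ _ c less_imp_neq[OF sin, symmetric]]
  have "?c ^^ n = id"
  proof (rule ext)
    fix v
    let ?x = "cosine_form S m s v" and ?y = "cosine_form S m t v"
    \<comment> \<open>\<open>\<alpha>\<close> and \<open>\<beta>\<close> solve the 2 by 2 Gram
      system, of determinant \<open>(sin \<theta>)\<^sup>2\<close>, that makes \<open>u\<close>
      orthogonal to both basis vectors.\<close>
    define \<alpha> where "\<alpha> = (?x + cos \<theta> * ?y) / (sin \<theta>)\<^sup>2"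
    define \<beta> where "\<beta> = (?y + cos \<theta> * ?x) / (sin \<theta>)\<^sup>2"
    define u where "u = plane s t v (- \<alpha>) (- \<beta>)"
    have v: "v = plane s t u \<alpha> \<beta>" by (simp add: u_def plane_def)
    have c': "cosine m t s = - cos \<theta>" using c cosine_commute[OF st(1,2)] by simp
    have sq: "(cos \<theta>)\<^sup>2 = 1 - (sin \<theta>)\<^sup>2" by (rule cos_squared_eq)
    have "cosine_form S m s u = ?x - \<alpha> + \<beta> * cos \<theta>" "cosine_form S m t u = ?y + \<alpha> * cos \<theta> - \<beta>"
      unfolding u_def cosine_form_plane[OF st(1,2)] by (simp_all add: c c')
    moreover have "\<alpha> - \<beta> * cos \<theta> = ?x * (1 - (cos \<theta>)\<^sup>2) / (sin \<theta>)\<^sup>2"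
      "\<beta> - \<alpha> * cos \<theta> = ?y * (1 - (cos \<theta>)\<^sup>2) / (sin \<theta>)\<^sup>2"
      using sin unfolding \<alpha>_def \<beta>_def by (simp_all add: field_simps power2_eq_square)
    then have "\<alpha> - \<beta> * cos \<theta> = ?x" "\<beta> - \<alpha> * cos \<theta> = ?y"
      using sin by (simp_all add: sq)
    ultimately have u: "cosine_form S m s u = 0" "cosine_form S m t u = 0" by simp_all
    have n\<theta>: "2 * real n * \<theta> = 2 * pi" using n2 by (simp add: \<theta>_def)
    show "(?c ^^ n) v = id v"
      using sin by (simp only: v pow[OF u] n\<theta>) (simp add: sin_diff sin_add)
  qed
  then have "?c ^^ (n * j) = id" for j by (metis funpow_mult id_funpow)
  moreover have "n dvd k" if id: "?c ^^ k = id"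
  proof -
    \<comment> \<open>A power fixing the basis vector at \<open>s\<close> must have its angle
      \<open>2 * k * \<theta>\<close> in the multiples of \<open>2 * pi\<close>.\<close>
    let ?e = "plane s t (\<lambda>_. 0) 1 0"
    have zero: "cosine_form S m r (\<lambda>_. 0) = 0" for r by (simp add: cosine_form_def)
    have "?e = plane s t (\<lambda>_. 0) (sin (2 * real k * \<theta> + \<theta>) / sin \<theta>) (sin (2 * real k * \<theta>) / sin \<theta>)"
      using pow[OF zero zero, of k 1 0] id by simp
    from fun_cong[OF this, of s] fun_cong[OF this, of t]
    have "sin (2 * real k * \<theta> + \<theta>) = sin \<theta>" "sin (2 * real k * \<theta>) = 0"
      using st(3) sin by (simp_all add: plane_def)
    then have "cos (2 * real k * \<theta>) = 1" using sin by (simp add: sin_add)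
    then obtain j :: int where "2 * real k * \<theta> = real_of_int j * 2 * pi"
      using cos_one_2pi_int by blast
    then have "real k = real_of_int j * real n" using n2 by (simp add: \<theta>_def field_simps)
    then have "int k = j * int n" by (metis of_int_eq_iff of_int_mult of_int_of_nat_eq)
    then show ?thesis by (metis dvd_triv_right int_dvd_int_iff)
  qed
  ultimately show ?thesis by (metis dvdE)
qed

text \<open>Here the form degenerates on the plane and the product acts unipotently: the coordinates
  grow linearly with the exponent.\<close>

lemma rotation_infinite_order:
  assumes st: "s \<in> S" "t \<in> S" "s \<noteq> t" and inf: "m s t = \<infinity>"
  shows "(reflection S m s \<circ> reflection S m t) ^^ k = id \<longleftrightarrow> k = 0"
proof
  assume id: "(reflection S m s \<circ> reflection S m t) ^^ k = id"
  have zero: "cosine_form S m r (\<lambda>_. 0) = 0" for r by (simp add: cosine_form_def)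
  have c: "cosine m s t = - 1" using st inf by (simp add: cosine_def)
  have "((reflection S m s \<circ> reflection S m t) ^^ k) (plane s t (\<lambda>_. 0) 1 0) =
      plane s t (\<lambda>_. 0) (2 * real k + 1) (2 * real k)" for k
  proof (induction k)
    case (Suc k)
    then show ?case using rotation_plane[OF st(1,2) zero zero] by (simp add: c add.commute)
  qed simp
  from fun_cong[OF this, of k t] show "k = 0" using id st(3) by (simp add: plane_def)
qed simp

lemma ord_rotation:
  assumes st: "s \<in> S" "t \<in> S" "s \<noteq> t"
  shows "group.ord lin_group (reflection S m s \<circ> reflection S m t) =
    (case m s t of enat n \<Rightarrow> n | \<infinity> \<Rightarrow> 0)" (is "?o = ?n")
proof -
  interpret group "lin_group :: (('a \<Rightarrow> real) \<Rightarrow> 'a \<Rightarrow> real) monoid" by (rule group_lin_group)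
  have "reflection S m s \<circ> reflection S m t \<in> carrier lin_group"
    using m_closed[OF reflection_in_lin_group reflection_in_lin_group] st by simp
  from pow_eq_id[OF this] have "?o dvd k \<longleftrightarrow> ?n dvd k" for k
    using rotation_finite_order[OF st] rotation_infinite_order[OF st]
    by (cases "m s t") (simp_all add: lin_group_pow)
  then show ?thesis by (metis dvd_antisym dvd_refl)
qed

lemma reflection_braid:
  assumes st: "s \<in> S" "t \<in> S" "s \<noteq> t"
  shows "alt_prod lin_group n (reflection S m s) (reflection S m t) =
      alt_prod lin_group n (reflection S m t) (reflection S m s) \<longleftrightarrow>
    (case m s t of enat k \<Rightarrow> k | \<infinity> \<Rightarrow> 0) dvd n"
proof -
  interpret group "lin_group :: (('a \<Rightarrow> real) \<Rightarrow> 'a \<Rightarrow> real) monoid" by (rule group_lin_group)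
  show ?thesis
    using braid_iff_ord_dvd[of "reflection S m s" "reflection S m t" n] st
    by (simp add: reflection_in_lin_group reflection_involution ord_rotation)
qed

end

section \<open>Obstructions to retractions\<close>

lemma generate_hom_image:
  assumes "group G" "group H" "\<phi> \<in> hom G H" "A \<subseteq> carrier G" "x \<in> generate G A"
  shows "\<phi> x \<in> generate H (\<phi> ` A)"
  using group_hom.generate_img[of G H \<phi> A] assms
  by (auto simp: group_hom_def group_hom_axioms_def)

lemma alt_prod_hom:
  assumes "group G" "group H" "\<phi> \<in> hom G H" "x \<in> carrier G" "y \<in> carrier G"
  shows "\<phi> (alt_prod G n x y) = alt_prod H n (\<phi> x) (\<phi> y)"
proof -
  interpret group_hom G H \<phi> using assms by (simp add: group_hom_def group_hom_axioms_def)
  show ?thesis using assms(4,5) by (induction n arbitrary: x y) simp_all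
qed

context labelled_set
begin

text \<open>
  In the Tits representation the image of \<open>t\<close> under a retraction to \<open>{s, r}\<close> lies in a dihedral
  group, where its odd braid relation with \<open>s\<close> forces it to equal \<open>s\<close>. So the relation between
  \<open>t\<close> and \<open>r\<close> becomes one between \<open>s\<close> and \<open>r\<close>.
\<close>

lemma odd_label_obstruction:
  assumes adm: "admits_parabolic_retractions S m"
    and S: "s \<in> S" "t \<in> S" "r \<in> S" and ne: "s \<noteq> t" "t \<noteq> r" "s \<noteq> r"
    and p: "m s t = enat p" "odd p" and q: "m t r = enat q"
    and sr: "m s r = \<infinity> \<or> (\<exists>k. m s r = enat k \<and> coprime p k \<and> \<not> k dvd q)"
  shows False
proof -
  let ?A = "artin_group S m" and ?L = "lin_group :: (('a \<Rightarrow> real) \<Rightarrow> 'a \<Rightarrow> real) monoid"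
    and ?g = "artin_gen S m" and ?\<sigma> = "reflection S m"
  interpret A: group ?A by (rule group_artin_group)
  interpret L: group ?L by (rule group_lin_group)
  have "?\<sigma> ` S \<subseteq> carrier ?L" using reflection_in_lin_group by auto
  from L.artin_group_hom_exists[OF this, of m] obtain \<phi>
    where \<phi>: "\<phi> \<in> hom ?A ?L" and \<phi>_gen: "\<And>s. s \<in> S \<Longrightarrow> \<phi> (?g s) = ?\<sigma> s"
    by (auto simp: reflection_braid)
  obtain \<rho> where "retraction_to ?A (std_parabolic S m {s, r}) \<rho>"
    using adm S unfolding admits_parabolic_retractions_def by (metis empty_subsetI insert_subset)
  then have \<rho>: "\<rho> \<in> hom ?A (?A\<lparr>carrier := std_parabolic S m {s, r}\<rparr>)"
    and \<rho>_id: "\<And>h. h \<in> std_parabolic S m {s, r} \<Longrightarrow> \<rho> h = h"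
    unfolding retraction_to_def by auto
  have g: "?g s \<in> carrier ?A" "?g t \<in> carrier ?A" "?g r \<in> carrier ?A"
    using S by (simp_all add: artin_gen_closed)
  have sub: "?g ` {s, r} \<subseteq> carrier ?A" using g by simp
  have H: "subgroup (std_parabolic S m {s, r}) ?A"
    unfolding std_parabolic_def by (rule A.generate_is_subgroup[OF sub])
  have \<rho>A: "\<rho> \<in> hom ?A ?A"
    using \<rho> subgroup.subset[OF H] by (auto simp: hom_def)
  have "?g s \<in> std_parabolic S m {s, r}" "?g r \<in> std_parabolic S m {s, r}"
    unfolding std_parabolic_def by (auto intro: generate.incl)
  then have \<rho>_gen: "\<rho> (?g s) = ?g s" "\<rho> (?g r) = ?g r" using \<rho>_id by auto
  have \<psi>: "\<phi> \<circ> \<rho> \<in> hom ?A ?L" using \<rho>A \<phi> by (rule hom_compose)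
  define z where "z = (\<phi> \<circ> \<rho>) (?g t)"
  have \<psi>_gen: "(\<phi> \<circ> \<rho>) (?g s) = ?\<sigma> s" "(\<phi> \<circ> \<rho>) (?g r) = ?\<sigma> r"
    using \<rho>_gen \<phi>_gen S by auto
  have braid: "alt_prod ?L n ((\<phi> \<circ> \<rho>) (?g x)) ((\<phi> \<circ> \<rho>) (?g y)) =
      alt_prod ?L n ((\<phi> \<circ> \<rho>) (?g y)) ((\<phi> \<circ> \<rho>) (?g x))"
    if "x \<in> S" "y \<in> S" "x \<noteq> y" "m x y = enat n" for x y n
    using artin_gen_braid[of x S y m n] that
      alt_prod_hom[OF A.group_axioms L.group_axioms \<psi> artin_gen_closed[of x] artin_gen_closed[of y], of n]
      alt_prod_hom[OF A.group_axioms L.group_axioms \<psi> artin_gen_closed[of y] artin_gen_closed[of x], of n]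
    by simp
  have "\<rho> (?g t) \<in> generate ?A (?g ` {s, r})"
    using \<rho> g(2) by (auto simp: hom_def std_parabolic_def)
  then have "z \<in> generate ?L (\<phi> ` ?g ` {s, r})"
    unfolding z_def comp_apply
    by (rule generate_hom_image[OF A.group_axioms L.group_axioms \<phi> sub])
  then have z: "z \<in> generate ?L {?\<sigma> s, ?\<sigma> r}" using \<phi>_gen S by simp
  have "L.ord (?\<sigma> s \<circ> ?\<sigma> r) = 0 \<or> coprime p (L.ord (?\<sigma> s \<circ> ?\<sigma> r))"
    using sr S ne by (auto simp: ord_rotation)
  moreover have "alt_prod ?L p (?\<sigma> s) z = alt_prod ?L p z (?\<sigma> s)"
    using braid[OF S(1,2) ne(1) p(1)] unfolding \<psi>_gen z_def .
  ultimately have "z = ?\<sigma> s"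
    using L.dihedral_odd_braid[of "?\<sigma> s" "?\<sigma> r" z p] z p(2) S
    by (simp add: reflection_in_lin_group reflection_involution)
  then have "alt_prod ?L q (?\<sigma> s) (?\<sigma> r) = alt_prod ?L q (?\<sigma> r) (?\<sigma> s)"
    using braid[OF S(2,3) ne(2) q] unfolding \<psi>_gen z_def by simp
  then have "(case m s r of enat k \<Rightarrow> k | \<infinity> \<Rightarrow> 0) dvd q"
    using reflection_braid[OF S(1,3) ne(3)] by simp
  \<comment> \<open>For an infinite label the divisor is 0, which cannot divide the positive
    \<open>q\<close>.\<close>
  moreover have "q \<noteq> 0" using label_ge_2[OF S(2,3) ne(2) q] by simp
  ultimately show False using sr by auto
qed

end

section \<open>Finite Coxeter groups of rank three\<close>

lemma lin_opD: "lin_op f \<Longrightarrow> f (\<lambda>x. a * u x + b * v x) = (\<lambda>x. a * f u x + b * f v x)"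
  by (simp add: lin_op_def)

text \<open>Averaging, up to a factor: the dot product on the coordinates in \<open>S\<close> is
  pulled back along each map in \<open>F\<close> and summed.\<close>

definition inv_form ::
    "(('a \<Rightarrow> real) \<Rightarrow> 'a \<Rightarrow> real) set \<Rightarrow> 'a set \<Rightarrow> ('a \<Rightarrow> real) \<Rightarrow> ('a \<Rightarrow> real) \<Rightarrow> real" where
  "inv_form F S u v = (\<Sum>f\<in>F. \<Sum>x\<in>S. f u x * f v x)"

lemma inv_form_commute: "inv_form F S u v = inv_form F S v u"
  by (simp add: inv_form_def mult.commute)

lemma inv_form_linear:
  assumes "\<And>f. f \<in> F \<Longrightarrow> lin_op f"
  shows "inv_form F S (\<lambda>x. a * u x + b * v x) w = a * inv_form F S u w + b * inv_form F S v w"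
proof -
  have "inv_form F S (\<lambda>x. a * u x + b * v x) w =
      (\<Sum>f\<in>F. \<Sum>x\<in>S. (a * f u x + b * f v x) * f w x)"
    unfolding inv_form_def using assms by (intro sum.cong) (simp_all add: lin_opD)
  also have "\<dots> = a * inv_form F S u w + b * inv_form F S v w"
    by (simp add: inv_form_def sum_distrib_left algebra_simps sum.distrib)
  finally show ?thesis .
qed

lemma inv_form_pos:
  assumes "finite F" "id \<in> F" "finite S" "x \<in> S" "u x \<noteq> 0"
  shows "inv_form F S u u > 0"
proof -
  have "0 < (\<Sum>x\<in>S. u x * u x)"
    using assms by (intro sum_pos2[of S x]) (auto simp: zero_less_mult_iff)
  also have "\<dots> = (\<Sum>f\<in>{id}. \<Sum>x\<in>S. f u x * f u x)" by simp
  also have "\<dots> \<le> inv_form F S u u"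
    unfolding inv_form_def using assms by (intro sum_mono2) (auto intro: sum_nonneg)
  finally show ?thesis .
qed

context labelled_set
begin

text \<open>\<open>F\<close> is the image of the finite Coxeter group in the Tits representation.
  Composition on the right is the one that permutes the summands of \<open>inv_form\<close>.\<close>

lemma spherical_invariant_set:
  assumes "spherical_type S m"
  shows "\<exists>F. finite F \<and> id \<in> F \<and> (\<forall>f\<in>F. lin_op f) \<and> (\<forall>s\<in>S. \<forall>f\<in>F. f \<circ> reflection S m s \<in> F)"
proof -
  let ?W = "coxeter_group S m" and ?L = "lin_group :: (('a \<Rightarrow> real) \<Rightarrow> 'a \<Rightarrow> real) monoid"
  interpret W: group ?W by (rule group_coxeter_group)
  interpret L: group ?L by (rule group_lin_group)
  have "reflection S m ` S \<subseteq> carrier ?L" using reflection_in_lin_group by auto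
  from L.coxeter_group_hom_exists[OF this, of m] obtain \<phi>
    where \<phi>: "\<phi> \<in> hom ?W ?L" and gen: "\<And>s. s \<in> S \<Longrightarrow> reflection S m s \<in> \<phi> ` carrier ?W"
    by (auto simp: reflection_braid reflection_involution)
  interpret \<phi>: group_hom ?W ?L \<phi> by unfold_locales (rule \<phi>)
  interpret F: subgroup "\<phi> ` carrier ?W" ?L by (rule \<phi>.img_is_subgroup)
  have "finite (\<phi> ` carrier ?W)" using assms by (simp add: spherical_type_def)
  moreover have "id \<in> \<phi> ` carrier ?W" using F.one_closed by simp
  moreover have "\<forall>f\<in>\<phi> ` carrier ?W. lin_op f" using F.subset lin_group_carrierD by auto
  moreover have "\<forall>s\<in>S. \<forall>f\<in>\<phi> ` carrier ?W. f \<circ> reflection S m s \<in> \<phi> ` carrier ?W"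
    using F.m_closed[OF _ gen] by simp
  ultimately show ?thesis by blast
qed

text \<open>
  Every reflection is also orthogonal for the averaged form, so that form is the cosine form up to
  a scaling of each vector of the basis.
\<close>

lemma spherical_form:
  assumes "spherical_type S m"
  obtains P :: "('a \<Rightarrow> real) \<Rightarrow> ('a \<Rightarrow> real) \<Rightarrow> real" where
    "\<And>u v. P u v = P v u"
    "\<And>a b u v w. P (\<lambda>x. a * u x + b * v x) w = a * P u w + b * P v w"
    "\<And>u x. x \<in> S \<Longrightarrow> u x \<noteq> 0 \<Longrightarrow> P u u > 0"
    "\<And>s t. s \<in> S \<Longrightarrow> t \<in> S \<Longrightarrow> P (\<lambda>x. of_bool (x = t)) (\<lambda>x. of_bool (x = s)) =
      cosine m s t * P (\<lambda>x. of_bool (x = s)) (\<lambda>x. of_bool (x = s))"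
proof -
  obtain F where F: "finite F" "id \<in> F" "\<And>f. f \<in> F \<Longrightarrow> lin_op f"
    and closed: "\<And>s f. s \<in> S \<Longrightarrow> f \<in> F \<Longrightarrow> f \<circ> reflection S m s \<in> F"
    using spherical_invariant_set[OF assms] by blast
  let ?P = "inv_form F S" and ?e = "\<lambda>s x. of_bool (x = s) :: real"
  have linear: "?P (\<lambda>x. a * u x + b * v x) w = a * ?P u w + b * ?P v w" for a b u v w
    by (rule inv_form_linear[OF F(3)])
  have "?P (?e t) (?e s) = cosine m s t * ?P (?e s) (?e s)" if s: "s \<in> S" and t: "t \<in> S" for s t
  proof -
    let ?\<sigma> = "reflection S m s"
    have inv: "f \<circ> ?\<sigma> \<circ> ?\<sigma> = f" for f :: "('a \<Rightarrow> real) \<Rightarrow> 'a \<Rightarrow> real"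
      using reflection_involution[OF s] by (simp add: comp_assoc)
    have "?P (?\<sigma> u) (?\<sigma> v) = ?P u v" for u v
      unfolding inv_form_def
      by (rule sum.reindex_bij_witness[where i = "\<lambda>f. f \<circ> ?\<sigma>" and j = "\<lambda>f. f \<circ> ?\<sigma>"])
        (simp_all add: inv closed[OF s])
    then have "?P (?e t) (?e s) = ?P (?\<sigma> (?e t)) (?\<sigma> (?e s))" by simp
    \<comment> \<open>Expanding gives \<open>P e_t e_s = - P e_t e_s + 2 c P e_s e_s\<close> with
      \<open>c = cosine m s t\<close>, whence the claim.\<close>
    also have "?\<sigma> (?e t) = (\<lambda>x. 1 * ?e t x + (- 2 * cosine m s t) * ?e s x)"
      by (simp add: reflection_def cosine_form_basis[OF t])
    also have "?\<sigma> (?e s) = (\<lambda>x. (- 1) * ?e s x + 0 * ?e s x)"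
      by (simp add: reflection_def cosine_form_basis[OF s] fun_eq_iff)
    finally show ?thesis
      unfolding linear by (subst (asm) (1 2) inv_form_commute, unfold linear) (simp add: inv_form_commute)
  qed
  then show ?thesis
    using that[of ?P] inv_form_commute linear inv_form_pos[OF F(1,2) finite_S] by blast
qed

end

section \<open>Labels of three generators of spherical type\<close>

lemma cos_pi_div_mono: "1 \<le> k \<Longrightarrow> k \<le> n \<Longrightarrow> cos (pi / real k) \<le> cos (pi / real n)"
  by (intro cos_monotone_0_pi_le) (auto simp: field_simps)

text \<open>Up to a positive factor this is the averaged form at
  \<open>x e_a + y e_b + z e_c\<close>. By its symmetry, the nonzero cosines at \<open>c\<close>
  force the three basis vectors to have equal length.\<close>

lemma (in labelled_set) spherical_triple_form_pos:
  assumes sph: "spherical_type S m" and S: "a \<in> S" "b \<in> S" "c \<in> S" and ne: "a \<noteq> b" "b \<noteq> c" "a \<noteq> c"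
    and nz: "cosine m a c \<noteq> 0" "cosine m b c \<noteq> 0" and z: "z \<noteq> 0"
  shows "0 < x\<^sup>2 + y\<^sup>2 + z\<^sup>2 + 2 * x * y * cosine m a b + 2 * x * z * cosine m a c + 2 * y * z * cosine m b c"
proof -
  obtain P where comm: "\<And>u v. P u v = P v u"
    and lin: "\<And>a b u v w. P (\<lambda>x. a * u x + b * v x) w = a * P u w + b * P v w"
    and pos: "\<And>u x. x \<in> S \<Longrightarrow> u x \<noteq> 0 \<Longrightarrow> P u u > 0"
    and cosine: "\<And>s t. s \<in> S \<Longrightarrow> t \<in> S \<Longrightarrow> P (\<lambda>x. of_bool (x = t)) (\<lambda>x. of_bool (x = s)) =
      cosine m s t * P (\<lambda>x. of_bool (x = s)) (\<lambda>x. of_bool (x = s))"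
    using spherical_form[OF sph] by blast
  define e :: "'a \<Rightarrow> 'a \<Rightarrow> real" where "e s = (\<lambda>x. of_bool (x = s))" for s
  have cosine': "P (e t) (e s) = cosine m s t * P (e s) (e s)" if "s \<in> S" "t \<in> S" for s t
    using cosine[OF that] by (simp add: e_def)
  have lin': "P w (\<lambda>x. a * u x + b * v x) = a * P w u + b * P w v" for a b u v w
    using lin[of a u b v w] by (simp add: comm)
  define k where "k = P (e c) (e c)"
  have diag: "P (e s) (e s) = k" if s: "s \<in> S" "cosine m s c \<noteq> 0" for s
  proof -
    have "cosine m s c * P (e s) (e s) = cosine m s c * k"
      using cosine'[OF s(1) S(3)] cosine'[OF S(3) s(1)]
      by (simp only: k_def comm[of "e s" "e c"] cosine_commute[OF S(3) s(1)])
    then show ?thesis using s(2) by simp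
  qed
  have "P (e c) (e c) = k" by (simp only: k_def)
  then have "P (e t) (e t) = k" if "t \<in> {a, b, c}" for t
    using that diag[OF S(1) nz(1)] diag[OF S(2) nz(2)] by blast
  moreover have "s \<in> S" if "s \<in> {a, b, c}" for s
    using S that by blast
  ultimately have scale: "P (e s) (e t) = cosine m s t * k" if "s \<in> {a, b, c}" "t \<in> {a, b, c}" for s t
    using cosine' cosine_commute that by metis
  define v where "v = (\<lambda>t. 1 * (x * e a t + y * e b t) + z * e c t)"
  have "v c \<noteq> 0" using z ne by (simp add: v_def e_def)
  then have "0 < P v v" using pos S by blast
  also have "P v v = k * (x\<^sup>2 + y\<^sup>2 + z\<^sup>2 + 2 * x * y * cosine m a b + 2 * x * z * cosine m a c
      + 2 * y * z * cosine m b c)"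
    unfolding v_def lin lin'
    by (simp add: scale S cosine_commute[of b a] cosine_commute[of c a] cosine_commute[of c b]
        power2_eq_square algebra_simps)
  finally show ?thesis
    using pos[of c "e c"] S by (simp add: k_def e_def zero_less_mult_iff)
qed

text \<open>Otherwise the labels dominate an affine triple. Larger labels only lower the form at
  vectors with nonnegative coordinates, so a null vector of the affine form contradicts
  positivity.\<close>

lemma (in labelled_set) spherical_triple_labels:
  assumes sph: "spherical_type S m" and S: "a \<in> S" "b \<in> S" "c \<in> S" and ne: "a \<noteq> b" "b \<noteq> c" "a \<noteq> c"
    and p: "m a b = enat p" and q: "m b c = enat q" and r: "m a c = enat r"
    and le: "p \<le> q" "q \<le> r"
  shows "q = 2 \<or> p = 2 \<and> q = 3 \<and> r \<le> 5"
proof (rule ccontr)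
  assume contr: "\<not> ?thesis"
  have p2: "2 \<le> p" using label_ge_2[OF S(1,2) ne(1) p] .
  have q3: "3 \<le> q" "3 \<le> r" using contr p2 le by linarith+
  have cos: "cosine m a b = - cos (pi / real p)" "cosine m b c = - cos (pi / real q)"
    "cosine m a c = - cos (pi / real r)"
    using p q r ne by (simp_all add: cosine_def)
  have half: "1 / 2 \<le> cos (pi / real n)" if "3 \<le> n" for n
    using cos_pi_div_mono[of 3 n] that by (simp add: cos_60)
  have "cosine m a c \<noteq> 0" "cosine m b c \<noteq> 0"
    using half[OF q3(1)] half[OF q3(2)] unfolding cos by linarith+
  \<comment> \<open>The remaining premise is \<open>z \<noteq> 0\<close>, so instantiations of
    \<open>pos\<close> list the coordinate at \<open>c\<close> first, then those at \<open>a\<close>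
    and \<open>b\<close>. The two larger labels meet at \<open>c\<close>.\<close>
  note pos = spherical_triple_form_pos[OF sph S ne this, unfolded cos]
  txt \<open>The test vectors below are null vectors for the affine labels
    \<open>(3, 3, 3)\<close>, \<open>(2, 4, 4)\<close> and \<open>(2, 3, 6)\<close>.\<close>
  consider "3 \<le> p" | "p = 2" "4 \<le> q" | "p = 2" "q = 3" "6 \<le> r"
    using contr p2 q3 by linarith
  then show False
  proof cases
    case 1
    then show False
      using pos[of 1 1 1] half[OF 1] half[OF q3(1)] half[OF q3(2)] by simp
  next
    case 2
    have "sqrt 2 / 2 \<le> cos (pi / real n)" if "4 \<le> n" for n
      using cos_pi_div_mono[of 4 n] that by (simp add: cos_45)
    then have "sqrt 2 / 2 \<le> cos (pi / real q)" "sqrt 2 / 2 \<le> cos (pi / real r)"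
      using 2 le by simp_all
    then have "sqrt 2 * (sqrt 2 / 2) \<le> sqrt 2 * cos (pi / real q)"
      "sqrt 2 * (sqrt 2 / 2) \<le> sqrt 2 * cos (pi / real r)"
      by (simp_all only: mult_left_mono real_sqrt_ge_zero zero_le_numeral)
    then show False using pos[of "sqrt 2" 1 1] 2 by (simp add: algebra_simps)
  next
    case 3
    have "sqrt 3 / 2 \<le> cos (pi / real r)"
      using cos_pi_div_mono[of 6 r] 3 by (simp add: cos_30)
    then have "sqrt 3 * (sqrt 3 / 2) \<le> sqrt 3 * cos (pi / real r)"
      by (simp only: mult_left_mono real_sqrt_ge_zero zero_le_numeral)
    then show False using pos[of 2 "sqrt 3" 1] 3 by (simp add: cos_60 algebra_simps)
  qed
qed

section \<open>The classification\<close>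

lemma admissible_triple_perm:
  assumes "admissible_triple p q r" "{#p, q, r#} = {#p', q', r'#}"
  shows "admissible_triple p' q' r'"
  using assms unfolding admissible_triple_def by simp

text \<open>Sorting puts infinite labels last. With one of them the obstruction makes the others
  even; with none, FC type bounds the labels and the obstruction removes the triples with middle
  label 3.\<close>

lemma (in labelled_set) admissible_if_sorted:
  assumes FC: "FC_type S m" and adm: "admits_parabolic_retractions S m"
    and S: "a \<in> S" "b \<in> S" "c \<in> S" and ne: "a \<noteq> b" "b \<noteq> c" "a \<noteq> c"
    and le: "m a b \<le> m b c" "m b c \<le> m a c"
  shows "admissible_triple (m a b) (m b c) (m a c)"
proof -
  note obstruct = odd_label_obstruction[OF adm]
  have sym: "m x y = m y x" if "x \<in> S" "y \<in> S" "x \<noteq> y" for x y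
    using labelling that by (auto simp: labelling_def)
  have ge: "2 \<le> m a b" "2 \<le> m b c" "2 \<le> m a c"
    using labelling S ne by (auto simp: labelling_def)
  show ?thesis
  proof (cases "m b c")
    case infinity
    then show ?thesis using ge le by (auto simp: admissible_triple_def)
  next
    case (enat q)
    with le obtain p where p: "m a b = enat p" by (cases "m a b") auto
    have p2: "2 \<le> p" "2 \<le> q" using label_ge_2 S ne p enat by blast+
    show ?thesis
    proof (cases "m a c")
      case infinity
      \<comment> \<open>Both finite labels meet at \<open>b\<close>, so an odd one would transport
        the other to the infinite edge between \<open>a\<close> and \<open>c\<close>.\<close>
      have "even p" using obstruct[of a b c p q] infinity S ne p enat by auto
      moreover have "even q"
        using obstruct[of c b a q p] infinity S ne p enat sym[of c b] sym[of b a] sym[of c a] by auto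
      ultimately obtain i j where "p = 2 * i" "q = 2 * j" by (auto elim!: evenE)
      then show ?thesis unfolding admissible_triple_def
        using p2 by (intro disjI2 disjI1 exI[of _ i] exI[of _ j]) (auto simp: infinity p enat)
    next
      case r: (enat r)
      have le': "p \<le> q" "q \<le> r" using le p enat r by simp_all
      interpret T: labelled_set "{a, b, c}" m
        using labelling S by unfold_locales (auto simp: labelling_def)
      have "spherical_type {a, b, c} m"
        using FC S ne p enat r sym[of a b] sym[of b c] sym[of a c] unfolding FC_type_def by auto
      from T.spherical_triple_labels[OF this _ _ _ ne p enat r le']
      consider "q = 2" | "p = 2" "q = 3" "r \<le> 5" by auto
      then show ?thesis
      proof cases
        case 1
        then have "p = 2" using p2 le' by simp
        then show ?thesis unfolding admissible_triple_def
          using 1 p2 le' by (intro disjI1 exI[of _ "enat r"]) (auto simp: p enat r numeral_eq_enat)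
      next
        case 2
        consider "r = 3 \<or> r = 5" | "r = 4" using 2 le' by linarith
        then show ?thesis
        proof cases
          case 1
          \<comment> \<open>Types (2,3,3) and (2,3,5): the label 3 carries the odd label
            \<open>r\<close> to the edge labelled 2, but 2 does not divide \<open>r\<close>.\<close>
          have "coprime 3 (2::nat)" by simp
          then show ?thesis
            using obstruct[of b c a 3 r] S ne p enat r 1 2 sym[of a b] sym[of a c]
            by auto
        next
          case r4: 2
          \<comment> \<open>Type (2,3,4): now the label 3 carries the label 2 to the edge labelled
            4, but 4 does not divide 2.\<close>
          have "coprime 3 (2 ^ 2 :: nat)" by (simp only: coprime_power_right_iff) simp
          then show ?thesis
            using obstruct[of c b a 3 2] S ne p enat r r4 2 sym[of a b] sym[of b c] sym[of a c]
            by auto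
        qed
      qed
    qed
  qed
qed

text \<open>Each of the six orders of the labels is the sorted case for a renaming of the three
  vertices.\<close>

lemma (in labelled_set) admissible_if_retractions:
  assumes FC: "FC_type S m" and adm: "admits_parabolic_retractions S m"
    and S: "a \<in> S" "b \<in> S" "c \<in> S" and ne: "a \<noteq> b" "b \<noteq> c" "a \<noteq> c"
  shows "admissible_triple (m a b) (m b c) (m a c)"
proof -
  have sym: "m a b = m b a" "m b c = m c b" "m a c = m c a"
    using labelling S ne by (auto simp: labelling_def)
  note sorted = admissible_if_sorted[OF FC adm]
  consider "m a b \<le> m b c" "m b c \<le> m a c" | "m a b \<le> m a c" "m a c \<le> m b c"
    | "m b c \<le> m a b" "m a b \<le> m a c" | "m b c \<le> m a c" "m a c \<le> m a b"
    | "m a c \<le> m a b" "m a b \<le> m b c" | "m a c \<le> m b c" "m b c \<le> m a b"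
    by (meson linear)
  then show ?thesis
  proof cases
    case 1 then show ?thesis using sorted S ne by simp
  next
    case 2
    then have "admissible_triple (m b a) (m a c) (m b c)" using sorted S ne sym by metis
    then show ?thesis by (rule admissible_triple_perm) (simp add: sym add_mset_commute)
  next
    case 3
    then have "admissible_triple (m c b) (m b a) (m c a)" using sorted S ne sym by metis
    then show ?thesis by (rule admissible_triple_perm) (simp add: sym add_mset_commute)
  next
    case 4
    then have "admissible_triple (m b c) (m c a) (m b a)" using sorted S ne sym by metis
    then show ?thesis by (rule admissible_triple_perm) (simp add: sym add_mset_commute)
  next
    case 5
    then have "admissible_triple (m c a) (m a b) (m c b)" using sorted S ne sym by metis
    then show ?thesis by (rule admissible_triple_perm) (simp add: sym add_mset_commute)
  next
    case 6
    then have "admissible_triple (m a c) (m c b) (m a b)" using sorted S ne sym by metis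
    then show ?thesis by (rule admissible_triple_perm) (simp add: sym add_mset_commute)
  qed
qed

section \<open>Sufficiency: the prescribed values respect the braid relations\<close>

lemma admissible_triple_odd:
  assumes adm: "admissible_triple p q r" and p: "odd_label p" and q: "q \<noteq> \<infinity>"
  shows "q = 2 \<and> r = 2"
proof -
  have p2: "p \<noteq> 2" "p \<noteq> \<infinity>" "p \<noteq> enat (2 * i)" for i
    using p by (auto simp: odd_label_def numeral_eq_enat)
  \<comment> \<open>Only the type (2,2,k) contains an odd label beside another finite one, and the
    odd label must be \<open>k\<close>.\<close>
  show ?thesis
    using adm p2 q unfolding admissible_triple_def by (auto simp: add_eq_conv_ex)
qed

locale admissible_set = labelled_set +
  assumes admissible: "\<And>a b c. a \<in> S \<Longrightarrow> b \<in> S \<Longrightarrow> c \<in> S \<Longrightarrow> a \<noteq> b \<Longrightarrow> b \<noteq> c \<Longrightarrow> a \<noteq> c \<Longrightarrow>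
    admissible_triple (m a b) (m b c) (m a c)"
begin

lemma label_sym: "x \<in> S \<Longrightarrow> y \<in> S \<Longrightarrow> x \<noteq> y \<Longrightarrow> m x y = m y x"
  using labelling by (auto simp: labelling_def)

lemma odd_finite_labels:
  assumes "a \<in> S" "b \<in> S" "c \<in> S" "a \<noteq> b" "b \<noteq> c" "a \<noteq> c" "odd_label (m b a)" "m b c \<noteq> \<infinity>"
  shows "m b c = 2 \<and> m a c = 2"
  using admissible_triple_odd[OF admissible[of a b c]] assms label_sym[of a b] by simp

text \<open>A second odd neighbour would have label 2. This is what gives the \<open>THE\<close> in
  \<open>rho_gen\<close> its meaning.\<close>

lemma odd_neighbour_unique:
  assumes "Y \<subseteq> S" "v \<in> S - Y" "a \<in> Y" "b \<in> Y" "odd_label (m v a)" "odd_label (m v b)"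
  shows "a = b"
proof (rule ccontr)
  assume "a \<noteq> b"
  moreover have "m v b \<noteq> \<infinity>" using assms(6) by (auto simp: odd_label_def)
  ultimately have "m v b = 2" using odd_finite_labels[of a v b] assms by auto
  then show False using assms(6) by (auto simp: odd_label_def numeral_eq_enat)
qed

lemma rho_gen_cases:
  assumes Y: "Y \<subseteq> S" and v: "v \<in> S"
  obtains "v \<in> Y" "rho_gen S m Y v = artin_gen S m v"
  | a where "v \<notin> Y" "a \<in> Y" "odd_label (m v a)" "rho_gen S m Y v = artin_gen S m a"
  | "v \<notin> Y" "\<And>a. a \<in> Y \<Longrightarrow> \<not> odd_label (m v a)" "rho_gen S m Y v = \<one>\<^bsub>artin_group S m\<^esub>"
proof -
  consider "v \<in> Y" | a where "v \<notin> Y" "a \<in> Y" "odd_label (m v a)"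
    | "v \<notin> Y" "\<And>a. a \<in> Y \<Longrightarrow> \<not> odd_label (m v a)" by blast
  then show ?thesis
  proof cases
    case 2
    then have "(THE a. a \<in> Y \<and> odd_label (m v a)) = a"
      using odd_neighbour_unique[OF Y] v by blast
    then have "rho_gen S m Y v = artin_gen S m a" using 2 by (simp add: rho_gen_def) blast
    then show ?thesis using that(2) 2 by simp
  qed (use that in \<open>auto simp: rho_gen_def\<close>)
qed

lemma artin_gen_commute:
  assumes "a \<in> S" "b \<in> S" "a \<noteq> b" "m a b = 2"
  shows "artin_gen S m a \<otimes>\<^bsub>artin_group S m\<^esub> artin_gen S m b =
    artin_gen S m b \<otimes>\<^bsub>artin_group S m\<^esub> artin_gen S m a"
proof -
  interpret group "artin_group S m" by (rule group_artin_group)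
  show ?thesis
    using artin_gen_braid[of a S b m 2] assms
    by (simp add: numeral_eq_enat numeral_2_eq_2 artin_gen_closed)
qed

text \<open>A trivial value commutes with everything. If an endpoint is replaced by its odd
  neighbour, the finite label beside that odd label forces label 2, hence commuting
  generators.\<close>

lemma rho_gen_commute:
  assumes Y: "Y \<subseteq> S" and S: "s \<in> S" "t \<in> S" and st: "s \<noteq> t" "m s t = enat n" "even n"
    and not_Y: "\<not> (s \<in> Y \<and> t \<in> Y)"
  shows "rho_gen S m Y s \<otimes>\<^bsub>artin_group S m\<^esub> rho_gen S m Y t =
    rho_gen S m Y t \<otimes>\<^bsub>artin_group S m\<^esub> rho_gen S m Y s"
proof -
  interpret group "artin_group S m" by (rule group_artin_group)
  have even: "\<not> odd_label (m s t)" "\<not> odd_label (m t s)" and fin: "m s t \<noteq> \<infinity>" "m t s \<noteq> \<infinity>"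
    using st label_sym[OF S st(1)] by (auto simp: odd_label_def)
  note odd = odd_finite_labels
  have one: "artin_gen S m x \<otimes>\<^bsub>artin_group S m\<^esub> \<one>\<^bsub>artin_group S m\<^esub> =
      \<one>\<^bsub>artin_group S m\<^esub> \<otimes>\<^bsub>artin_group S m\<^esub> artin_gen S m x" if "x \<in> S" for x
    using artin_gen_closed[OF that] by simp
  have sub: "x \<in> S" if "x \<in> Y" for x using Y that by blast
  show ?thesis
  proof (rule rho_gen_cases[OF Y S(1)]; rule rho_gen_cases[OF Y S(2)])
    fix a assume s: "s \<in> Y" "rho_gen S m Y s = artin_gen S m s"
      and a: "t \<notin> Y" "a \<in> Y" "odd_label (m t a)" "rho_gen S m Y t = artin_gen S m a"
    then have "a \<noteq> s" "a \<noteq> t" using even by auto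
    then have "m a s = 2" using odd[of a t s] a sub S st fin by auto
    then show ?thesis using artin_gen_commute[of a s] \<open>a \<noteq> s\<close> a s sub by simp
  next
    fix a assume t: "t \<in> Y" "rho_gen S m Y t = artin_gen S m t"
      and a: "s \<notin> Y" "a \<in> Y" "odd_label (m s a)" "rho_gen S m Y s = artin_gen S m a"
    then have "a \<noteq> t" "a \<noteq> s" using even by auto
    then have "m a t = 2" using odd[of a s t] a sub S st fin by auto
    then show ?thesis using artin_gen_commute[of a t] \<open>a \<noteq> t\<close> a t sub by simp
  next
    fix a b assume a: "s \<notin> Y" "a \<in> Y" "odd_label (m s a)" "rho_gen S m Y s = artin_gen S m a"
      and b: "t \<notin> Y" "b \<in> Y" "odd_label (m t b)" "rho_gen S m Y t = artin_gen S m b"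
    have ne: "a \<noteq> s" "a \<noteq> t" "b \<noteq> s" "b \<noteq> t" using a b by auto
    show ?thesis
    proof (cases "a = b")
      case False
      \<comment> \<open>Two transports: the odd edge from \<open>t\<close> to \<open>b\<close> gives
        label 2 between \<open>b\<close> and \<open>s\<close>; this finite label beside the odd edge
        from \<open>s\<close> to \<open>a\<close> gives label 2 between \<open>a\<close> and
        \<open>b\<close>.\<close>
      have "m b s = 2" using odd[of b t s] ne b sub S st fin by auto
      then have "m s b \<noteq> \<infinity>" using label_sym[of s b] S sub b ne by simp
      then have "m a b = 2" using odd[of a s b] ne a b sub S False by auto
      then show ?thesis using artin_gen_commute[of a b] False a b sub by simp
    qed (simp add: a b)
  qed (use not_Y one sub in \<open>auto\<close>)
qed

text \<open>An endpoint in \<open>Y\<close> is the unique odd neighbour of the other. If neither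
  lies in \<open>Y\<close>, an odd neighbour in \<open>Y\<close> would force
  \<open>m s t = 2\<close>, so both values are trivial.\<close>

lemma rho_gen_odd:
  assumes Y: "Y \<subseteq> S" and S: "s \<in> S" "t \<in> S" and st: "s \<noteq> t" "m s t = enat n" "odd n"
    and not_Y: "\<not> (s \<in> Y \<and> t \<in> Y)"
  shows "rho_gen S m Y s = rho_gen S m Y t"
proof -
  have odd: "odd_label (m s t)" "odd_label (m t s)" and fin: "m s t \<noteq> \<infinity>" "m t s \<noteq> \<infinity>"
    and ne2: "m s t \<noteq> 2" "m t s \<noteq> 2"
    using st label_sym[OF S st(1)] by (auto simp: odd_label_def numeral_eq_enat)
  have sub: "x \<in> S" if "x \<in> Y" for x using Y that by blast
  have one: "\<not> odd_label (m s a)" "\<not> odd_label (m t a)" if "s \<notin> Y" "t \<notin> Y" "a \<in> Y" for a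
  proof -
    have a: "a \<in> S" "a \<noteq> s" "a \<noteq> t" using that sub by auto
    show "\<not> odd_label (m s a)"
      using odd_finite_labels[OF a(1) S a(2) st(1) a(3) _ fin(1)] ne2 by blast
    show "\<not> odd_label (m t a)"
      using odd_finite_labels[OF a(1) S(2,1) a(3) st(1)[symmetric] a(2) _ fin(2)] ne2 by blast
  qed
  note unique = odd_neighbour_unique[OF Y]
  show ?thesis
  proof (rule rho_gen_cases[OF Y S(1)]; rule rho_gen_cases[OF Y S(2)])
    fix a assume "s \<in> Y" "rho_gen S m Y s = artin_gen S m s"
      and a: "t \<notin> Y" "a \<in> Y" "odd_label (m t a)" "rho_gen S m Y t = artin_gen S m a"
    then show ?thesis using unique[of t a s] S odd by simp
  next
    fix a assume "t \<in> Y" "rho_gen S m Y t = artin_gen S m t"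
      and a: "s \<notin> Y" "a \<in> Y" "odd_label (m s a)" "rho_gen S m Y s = artin_gen S m a"
    then show ?thesis using unique[of s a t] S odd by simp
  qed (use not_Y one odd in \<open>auto\<close>)
qed

text \<open>Edges inside \<open>Y\<close> keep their own relation; on all others the values coincide
  for odd labels and commute for even ones, so both alternating products agree.\<close>

lemma rho_gen_retraction:
  assumes Y: "Y \<subseteq> S"
  shows "\<exists>\<rho>. retraction_to (artin_group S m) (std_parabolic S m Y) \<rho> \<and>
    (\<forall>v\<in>S. \<rho> (artin_gen S m v) = rho_gen S m Y v)"
proof -
  interpret group "artin_group S m" by (rule group_artin_group)
  have closed: "rho_gen S m Y v \<in> std_parabolic S m Y" if "v \<in> S" for v
    by (rule rho_gen_cases[OF Y that])
      (auto simp: std_parabolic_def intro: generate.incl generate.one)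
  have "artin_gen S m ` Y \<subseteq> carrier (artin_group S m)"
    using Y by (auto simp: artin_gen_closed)
  then have carr: "rho_gen S m Y v \<in> carrier (artin_group S m)" if "v \<in> S" for v
    using closed[OF that] generate_in_carrier unfolding std_parabolic_def by blast
  show ?thesis
  proof (rule retraction_from_generators[where f = "rho_gen S m Y", OF Y])
    show "rho_gen S m Y v \<in> std_parabolic S m Y" if "v \<in> S" for v
      using that by (rule closed)
    show "rho_gen S m Y v = artin_gen S m v" if "v \<in> Y" for v
      using that by (simp add: rho_gen_def)
    fix n s t assume st: "s \<in> S" "t \<in> S" "s \<noteq> t" "m s t = enat n"
    show "alt_prod (artin_group S m) n (rho_gen S m Y s) (rho_gen S m Y t) =
        alt_prod (artin_group S m) n (rho_gen S m Y t) (rho_gen S m Y s)"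
    proof (cases "s \<in> Y \<and> t \<in> Y")
      case True
      then show ?thesis using artin_gen_braid[of s S t m n] st by (simp add: rho_gen_def)
    next
      case False
      then show ?thesis
        using rho_gen_odd[OF Y st _ False] rho_gen_commute[OF Y st _ False] alt_prod_commute carr st
        by (cases "odd n") simp_all
    qed
  qed
qed

end

theorem theorem2p6:
  fixes S :: "'a set" and m :: "'a \<Rightarrow> 'a \<Rightarrow> enat"
  assumes "finite S"
    and "labelling S m"
    and "FC_type S m"
  shows "(admits_parabolic_retractions S m \<longleftrightarrow>
           (\<forall>a\<in>S. \<forall>b\<in>S. \<forall>c\<in>S. a \<noteq> b \<and> b \<noteq> c \<and> a \<noteq> c \<longrightarrow>
              admissible_triple (m a b) (m b c) (m a c))) \<and>
         (admits_parabolic_retractions S m \<longrightarrow>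
           (\<forall>Y\<subseteq>S.
              (\<forall>v\<in>S - Y. \<forall>a\<in>Y. \<forall>b\<in>Y. odd_label (m v a) \<and> odd_label (m v b) \<longrightarrow> a = b) \<and>
              (\<exists>\<rho>. retraction_to (artin_group S m) (std_parabolic S m Y) \<rho> \<and>
                   (\<forall>v\<in>S. \<rho> (artin_gen S m v) = rho_gen S m Y v))))"
    (is "(?adm \<longleftrightarrow> ?triples) \<and> (?adm \<longrightarrow> ?rho)")
proof -
  interpret labelled_set S m using assms by unfold_locales
  \<comment> \<open>The implications are proved in a cycle: retractions give the triples, these give
    the prescribed retractions, and those are in particular retractions.\<close>
  have triples: ?triples if ?adm
    using admissible_if_retractions[OF assms(3) that] by blast
  have rho: ?rho if ?triples
  proof -
    interpret admissible_set S m using that by unfold_locales blast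
    show ?thesis
      by (intro allI impI conjI rho_gen_retraction ballI)
        (blast intro: odd_neighbour_unique)
  qed
  have adm: "?adm" if ?rho
    unfolding admits_parabolic_retractions_def
  proof (intro allI impI)
    fix Y assume "Y \<subseteq> S"
    with that show "\<exists>\<rho>. retraction_to (artin_group S m) (std_parabolic S m Y) \<rho>" by auto
  qed
  show ?thesis
    by (intro conjI iffI impI) (erule triples adm[OF rho] rho[OF triples])+
qed

end
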